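(* Let $f:\mathbb{C}\to\mathbb{C}$ be a non-constant entire function. Write $f(M_n(\mathbb{C}))=\{f(A): A\in M_n(\mathbb{C})\}$ for the range of the induced map $f:M_n(\mathbb{C})\to M_n(\mathbb{C})$. (i) If $f$ omits a complex value $a$ (i.e. $f(z)\neq a$ for all $z\in\mathbb{C}$), then $f(M_n(\mathbb{C}))=M_n(\mathbb{C})\setminus E_a$. (ii) If $f$ takes on all complex values and has no totally ramified values, then $f(M_n(\mathbb{C}))=M_n(\mathbb{C})$. (iii) If $f$ has exactly one totally ramified value $a$, then $f(M_n(\mathbb{C}))=M_n(\mathbb{C})\setminus S^f_a$ for a set $S^f_a$ with $\emptyset\neq S^f_a\subseteq S_a$. Moreover, $S^f_a=S_a$ if and only if each root of the equation $f(z)=a$ has multiplicity at least $n$. In particular, $S^f_a=S_a$ for $n=2$. (iv) If $f$ has two distinct totally ramified values $a$ and $b$, then there are sets $S^f_a\subseteq S_a$ and $S^f_b\subseteq S_b$ such that $f(M_n(\mathbb{C}))=M_n(\mathbb{C})\setminus(S^f_a\cup S^f_b)$. Moreover, $S^f_a$ and $S^f_b$ are non-empty proper subsets of $S_a$ and $S_b$, respectively, for $n\ge 3$, while $S^f_a=S_a$ and $S^f_b=S_b$ for $n=2$.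
   Context: $M_n(\mathbb{C})$ is the ring of all $n\times n$ matrices with complex entries, $n$ being a positive integer. An entire function $f:\mathbb{C}\to\mathbb{C}$ with power series $f(z)=\sum_{k=0}^\infty a_kz^k$ induces a map $f:M_n(\mathbb{C})\to M_n(\mathbb{C})$ by $f(A)=\sum_{k=0}^\infty a_kA^k$ (with $A^0=I$). A complex number $a$ is a totally ramified value of $f$ if the equation $f(z)=a$ has at least one root $z\in\mathbb{C}$ and all of its roots have multiplicity at least $2$ (the multiplicity of a root $z_0$ is the order of vanishing of $f-a$ at $z_0$). In particular, a value omitted by $f$ is not counted as a totally ramified value. A non-constant entire function has at most two totally ramified values. For $a\in\mathbb{C}$, $E_a$ is the set of all matrices $A\in M_n(\mathbb{C})$ that have $a$ as an eigenvalue, and $S_a\subset E_a$ is the set of all matrices $A\in M_n(\mathbb{C})$ whose Jordan form has at least one non-trivial Jordan block corresponding to $a$, that is, a Jordan block with eigenvalue $a$ of size at least $2$.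
   Formalization: In (iii), the claim that the set S^f_a is non-empty is made only for n ≥ 2; for n = 1 it is false, since S_a is then empty and f takes every value (for example f(z) = z², a = 0). *)

theory Defs
  imports
    "HOL-Complex_Analysis.Complex_Analysis"
    "Jordan_Normal_Form.Jordan_Normal_Form_Existence"
begin

text \<open>
  The type of matrices carries no topology, so the sum of the power series at a square matrix
  is taken entrywise; this is convergence in the space of matrices of a fixed size. The lemma
  below shows that every entry converges absolutely when \<open>f\<close> is entire.
\<close>

definition entire_mat :: "(complex \<Rightarrow> complex) \<Rightarrow> complex mat \<Rightarrow> complex mat" where
  "entire_mat f A = Matrix.mat (dim_row A) (dim_row A)
     (\<lambda>(i, j). \<Sum>k. fps_nth (fps_expansion f 0) k * (A ^\<^sub>m k) $$ (i, j))"

lemma summable_entire_mat: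
  assumes f: "f holomorphic_on UNIV" and A: "A \<in> carrier_mat n n" and i: "i < n" and j: "j < n"
  shows "summable (\<lambda>k. norm (fps_nth (fps_expansion f 0) k * (A ^\<^sub>m k) $$ (i, j)))"
proof -
  obtain b where b: "norm_bound A b"
    using norm_bound_max by blast
  have "0 \<le> b"
    using b A i j norm_ge_zero[of "A $$ (i, j)"] unfolding norm_bound_def
    by (metis carrier_matD order_trans)
  define C where "C = b * real n + 1"
  have C: "C \<ge> 1"
    using \<open>0 \<le> b\<close> by (simp add: C_def)
  have pow: "norm_bound (A ^\<^sub>m k) (C ^ k)" for k
  proof (induction k)
    case 0
    show ?case using A by (auto simp: norm_bound_def)
  next
    case (Suc k)
    have "norm_bound (A ^\<^sub>m k * A) (C ^ k * b * of_nat n)"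
      using A Suc b by (intro norm_bound_mult[of _ n n _ n]) auto
    moreover have "C ^ k * b * of_nat n \<le> C ^ Suc k"
      using C by (simp add: C_def algebra_simps)
    ultimately show ?case
      by (force simp: norm_bound_def intro: order_trans)
  qed
  have "fps_conv_radius (fps_expansion f 0) \<ge> \<infinity>"
    by (rule conv_radius_fps_expansion) (use f in \<open>auto intro: holomorphic_on_subset\<close>)
  then have "summable (\<lambda>k. norm (fps_nth (fps_expansion f 0) k * of_real C ^ k))"
    by (intro abs_summable_in_conv_radius) (auto simp: fps_conv_radius_def)
  then show ?thesis
  proof (rule summable_comparison_test')
    fix k
    have "norm ((A ^\<^sub>m k) $$ (i, j)) \<le> C ^ k"
      using pow[of k] A i j by (auto simp: norm_bound_def)
    then show "norm (norm (fps_nth (fps_expansion f 0) k * (A ^\<^sub>m k) $$ (i, j)))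
        \<le> norm (fps_nth (fps_expansion f 0) k * of_real C ^ k)"
      using C by (simp add: norm_mult norm_power mult_left_mono)
  qed
qed

definition totally_ramified_value :: "(complex \<Rightarrow> complex) \<Rightarrow> complex \<Rightarrow> bool" where
  "totally_ramified_value f a \<longleftrightarrow>
     (\<exists>z. f z = a) \<and> (\<forall>z. f z = a \<longrightarrow> zorder (\<lambda>w. f w - a) z \<ge> 2)"

definition eigenvalue_mats :: "nat \<Rightarrow> complex \<Rightarrow> complex mat set" where
  "eigenvalue_mats n a = {A \<in> carrier_mat n n. eigenvalue A a}"

definition nontrivial_block_mats :: "nat \<Rightarrow> complex \<Rightarrow> complex mat set" where
  "nontrivial_block_mats n a =
     {A \<in> carrier_mat n n. \<exists>n_as. jordan_nf A n_as \<and> (\<exists>k\<ge>2. (k, a) \<in> set n_as)}"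

end

theory Submission
  imports Defs "Jordan_Normal_Form.Jordan_Normal_Form_Uniqueness"
begin

text \<open>
  Both sides of the problem are invariant under similarity, so it is decided block by block. On a
  Jordan block with eigenvalue \<open>z\<close> the map induced by \<open>f\<close> is the upper triangular Toeplitz matrix of
  the Taylor coefficients of \<open>f\<close> at \<open>z\<close>. If \<open>f' z \<noteq> 0\<close>, this matrix is again similar to a single
  Jordan block, with eigenvalue \<open>f z\<close>; if \<open>f - f z\<close> vanishes to order \<open>m \<ge> 2\<close>, its nilpotent part is
  a unit times the \<open>m\<close>-th power of a nilpotent block, so for sizes at least \<open>2\<close> its Jordan blocks are shorter
  (\<open>entire_mat_block_size_bound\<close>), but not all trivial if \<open>m\<close> is smaller than the size. Hence a matrix
  lies in the range as soon as its eigenvalues are attained by \<open>f\<close> and no nontrivial block belongs to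
  a totally ramified value (\<open>mem_range_if_no_ramified_block\<close>); a full block at a totally ramified
  value is never attained; and a root of low multiplicity produces attained matrices with
  nontrivial blocks.

  What remains is a statement about \<open>f\<close> alone: how many values can be omitted or totally ramified,
  and with which multiplicities. The answer is Nevanlinna's defect relation for entire functions,
  \<open>(\<Sum>a\<in>P. 1 - 1 / m a) \<le> 1\<close> whenever all \<open>a\<close>-points have multiplicity at least
  \<open>m a \<ge> 2\<close> (\<open>ramification_defect\<close>). For an omitted value \<open>m a\<close> is arbitrary, so Picard's little theorem is
  contained in it. It excludes three totally ramified values, an omitted value together with a
  totally ramified one, and two totally ramified values of which one has only roots of
  multiplicity at least \<open>3\<close>.

  The defect relation is proved by negative curvature, in the manner of Ahlfors' lemma. If it fails,
  an explicit metric on the plane with singularities \<open>norm (w - a) powr - \<beta> a\<close> at the points of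
  \<open>P\<close>, where \<open>\<beta> a\<close> is slightly less than \<open>1 - 1 / m a\<close>, has curvature bounded above by a negative
  constant (\<open>conical_metric_bound\<close>), and its pullback along \<open>f\<close> is continuous and vanishes over \<open>P\<close>.
  At a point where the quotient of this pullback by the hyperbolic metric of the disc of radius \<open>R\<close>
  is largest, the curvatures compare, which bounds the pullback by a multiple of the hyperbolic
  metric. As \<open>R\<close> grows the latter tends to \<open>0\<close> and \<open>f\<close> is constant. The comparison needs no second
  derivatives: an algebraic identity splits each factor \<open>1 + (norm g)\<^sup>2\<close> at the maximum into the
  modulus of a holomorphic function and a factor that is minimal there, and the maximum modulus
  principle handles the rest (\<open>derivative_comparison_at_maximum\<close>).
\<close>

section \<open>A metric comparison on small circles and an explicit conical metric\<close>

lemma maximum_modulus_circle: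
  assumes "H holomorphic_on ball z0 e" and r: "0 < r" "r < e"
  shows "\<exists>z. dist z0 z = r \<and> norm (H z0) \<le> norm (H z)"
proof -
  have cont: "continuous_on (cball z0 r) H"
    using assms by (intro holomorphic_on_imp_continuous_on holomorphic_on_subset[OF assms(1)]) auto
  then have "continuous_on (sphere z0 r) (\<lambda>z. norm (H z))"
    by (intro continuous_intros) (auto intro: continuous_on_subset)
  moreover have "sphere z0 r \<noteq> {}" using r by simp
  ultimately obtain z where z: "z \<in> sphere z0 r" "\<And>y. y \<in> sphere z0 r \<Longrightarrow> norm (H y) \<le> norm (H z)"
    using continuous_attains_sup[OF compact_sphere] by blast
  have "norm (H z0) \<le> norm (H z)"
  proof (rule maximum_modulus_frontier[of H "cball z0 r"])
    show "H holomorphic_on interior (cball z0 r)"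
      using assms by (intro holomorphic_on_subset[OF assms(1)]) auto
  qed (use cont z r in auto)
  then show ?thesis using z by auto
qed

lemma one_plus_sum_le_prod:
  fixes x :: "'a \<Rightarrow> real"
  assumes "finite P" and "\<And>j. j \<in> P \<Longrightarrow> 0 \<le> x j"
  shows "1 + (\<Sum>j\<in>P. x j) \<le> (\<Prod>j\<in>P. 1 + x j)"
  using assms
proof (induction P rule: finite_induct)
  case (insert i P)
  have "1 + (x i + (\<Sum>j\<in>P. x j)) \<le> (1 + x i) * (1 + (\<Sum>j\<in>P. x j))"
    using insert by (simp add: algebra_simps sum_nonneg)
  also have "\<dots> \<le> (1 + x i) * (\<Prod>j\<in>P. 1 + x j)"
    using insert by (intro mult_left_mono) auto
  finally show ?case using insert by simp
qed simp

text \<open>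
  This replaces the comparison of Laplacians at a maximum. Of the three factors,
  \<open>norm (H z)\<close> cannot be smaller than \<open>norm (H z0)\<close> everywhere on a circle about \<open>z0\<close>. So every small
  circle carries a point where the remaining two factors have product at most \<open>1\<close>; dividing by the
  squared radius and letting it tend to \<open>0\<close> leaves the squared derivatives.
\<close>

lemma derivative_comparison_at_maximum:
  fixes q :: "'a \<Rightarrow> complex \<Rightarrow> complex"
  assumes P: "finite P" and e: "e > 0"
    and H: "H holomorphic_on ball z0 e" "H z0 \<noteq> 0"
    and q: "\<And>j. j \<in> P \<Longrightarrow> (q j has_field_derivative q' j) (at z0)" "\<And>j. j \<in> P \<Longrightarrow> q j z0 = 0"
    and p: "(p has_field_derivative p') (at z0)" "p z0 = 0"
    and le: "\<And>z. z \<in> ball z0 e \<Longrightarrow>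
        norm (H z) * (\<Prod>j\<in>P. 1 + (norm (q j z))\<^sup>2) * (1 - (norm (p z))\<^sup>2) \<le> norm (H z0)"
  shows "(\<Sum>j\<in>P. (norm (q' j))\<^sup>2) \<le> (norm p')\<^sup>2"
proof -
  have "\<exists>z. dist z0 z = e / real (k + 2) \<and> norm (H z0) \<le> norm (H z)" for k
    using e by (intro maximum_modulus_circle[OF H(1)]) (auto simp: field_simps add_pos_nonneg)
  then obtain \<zeta> where \<zeta>: "\<And>k. dist z0 (\<zeta> k) = e / real (k + 2)" "\<And>k. norm (H z0) \<le> norm (H (\<zeta> k))"
    by metis
  have ne: "\<zeta> k \<noteq> z0" for k using \<zeta>(1)[of k] e by auto
  have "(\<lambda>k. e / real (k + 2)) \<longlonglongrightarrow> 0"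
    using LIMSEQ_ignore_initial_segment[OF lim_const_over_n[of e], of 2] by simp
  then have "(\<lambda>k. dist (\<zeta> k) z0) \<longlonglongrightarrow> 0"
    by (simp only: \<zeta>(1)[symmetric] dist_commute[of z0])
  then have lim: "\<zeta> \<longlonglongrightarrow> z0" by (rule iffD2[OF tendsto_dist_iff])
  then have at: "filterlim \<zeta> (at z0) sequentially"
    using ne by (simp add: filterlim_at)
  have quot: "(\<lambda>k. (norm (h (\<zeta> k) / (\<zeta> k - z0)))\<^sup>2) \<longlonglongrightarrow> (norm h')\<^sup>2"
    if "(h has_field_derivative h') (at z0)" "h z0 = 0" for h h'
  proof -
    have "((\<lambda>x. h x / (x - z0)) \<longlongrightarrow> h') (at z0)"
      using that by (simp add: has_field_derivative_iff)
    from filterlim_compose[OF this at] show ?thesis by (intro tendsto_intros)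
  qed
  have small: "(\<lambda>k. (norm (q j (\<zeta> k)))\<^sup>2) \<longlonglongrightarrow> 0" if "j \<in> P" for j
  proof -
    have "(\<lambda>k. q j (\<zeta> k)) \<longlonglongrightarrow> q j z0"
      using DERIV_isCont[OF q(1)[OF that]] lim by (rule isCont_tendsto_compose)
    then show ?thesis using q(2)[OF that] by (auto intro!: tendsto_eq_intros)
  qed
  have ineq: "(\<Sum>j\<in>P. (norm (q j (\<zeta> k) / (\<zeta> k - z0)))\<^sup>2)
      \<le> (norm (p (\<zeta> k) / (\<zeta> k - z0)))\<^sup>2 * (1 + (\<Sum>j\<in>P. (norm (q j (\<zeta> k)))\<^sup>2))" for k
  proof -
    define s where "s = (\<Sum>j\<in>P. (norm (q j (\<zeta> k)))\<^sup>2)"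
    define x where "x = (norm (p (\<zeta> k)))\<^sup>2"
    define h where "h = (norm (\<zeta> k - z0))\<^sup>2"
    have h: "h > 0" using ne[of k] by (simp add: h_def)
    have s: "s \<ge> 0" by (simp add: s_def sum_nonneg)
    have "(1 + s) * (1 - x) \<le> 1"
    proof (cases "x \<le> 1")
      case True
      have "e / real (k + 2) < e / 1" using e by (intro divide_strict_left_mono) auto
      then have "\<zeta> k \<in> ball z0 e" using \<zeta>(1)[of k] by simp
      have "norm (H z0) * ((1 + s) * (1 - x))
          \<le> norm (H (\<zeta> k)) * ((\<Prod>j\<in>P. 1 + (norm (q j (\<zeta> k)))\<^sup>2) * (1 - x))"
        unfolding s_def using True s \<zeta>(2) one_plus_sum_le_prod[OF P, of "\<lambda>j. (norm (q j (\<zeta> k)))\<^sup>2"]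
        by (intro mult_mono mult_nonneg_nonneg prod_nonneg) (auto simp: s_def)
      also have "\<dots> \<le> norm (H z0) * 1"
        using le[OF \<open>\<zeta> k \<in> ball z0 e\<close>] by (simp add: x_def mult.assoc)
      finally show ?thesis using H(2) by simp
    next
      case False
      then have "(1 + s) * (1 - x) \<le> 0" using s by (intro mult_nonneg_nonpos) auto
      then show ?thesis by simp
    qed
    then have "s \<le> x * (1 + s)" by (simp add: algebra_simps)
    then have "s / h \<le> x / h * (1 + s)"
      using h by (simp add: divide_simps)
    then show ?thesis
      by (simp add: s_def x_def h_def norm_divide power_divide sum_divide_distrib)
  qed
  have "(\<lambda>k. (norm (p (\<zeta> k) / (\<zeta> k - z0)))\<^sup>2 * (1 + (\<Sum>j\<in>P. (norm (q j (\<zeta> k)))\<^sup>2)))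
      \<longlonglongrightarrow> (norm p')\<^sup>2 * (1 + (\<Sum>j\<in>P. 0))"
    by (intro tendsto_intros quot p small)
  moreover have "(\<lambda>k. \<Sum>j\<in>P. (norm (q j (\<zeta> k) / (\<zeta> k - z0)))\<^sup>2) \<longlonglongrightarrow> (\<Sum>j\<in>P. (norm (q' j))\<^sup>2)"
    by (intro tendsto_intros quot q)
  ultimately show ?thesis
    using ineq by (intro LIMSEQ_le) auto
qed

text \<open>
  The product on the left is the density of a conical metric. The Laplacian of its logarithm is the
  sum over \<open>a \<in> P\<close> of \<open>4 * c\<^sup>2\<close> times the squares of the fractions on the right, so the inequality
  bounds the Gaussian curvature of the metric above by a negative constant. The point \<open>a\<close> is the one of \<open>P\<close> nearest to \<open>w\<close>. Near \<open>a\<close> the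
  density behaves like \<open>norm (w - a) powr - \<beta> a\<close>, which is where \<open>\<beta> a \<le> 1 - c\<close> enters; near infinity
  the exponents add up to \<open>2 * c * card P - (\<Sum>b\<in>P. \<beta> b)\<close>, which the hypothesis on the sum makes at
  most \<open>- 1 - c\<close>, the exponent of the fraction there.
\<close>

lemma conical_metric_bound:
  fixes \<beta> :: "complex \<Rightarrow> real"
  assumes P: "finite P" and c: "c > 0" and \<beta>: "\<And>b. b \<in> P \<Longrightarrow> 0 \<le> \<beta> b \<and> \<beta> b \<le> 1 - c"
    and total: "c * (1 + 2 * real (card P)) \<le> (\<Sum>b\<in>P. \<beta> b) - 1"
  shows "\<exists>K>0. \<forall>w. w \<notin> P \<longrightarrow> (\<exists>a\<in>P.
      (\<Prod>b\<in>P. (1 + norm (w - b) powr (2 * c)) * norm (w - b) powr (- \<beta> b))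
        \<le> K * (norm (w - a) powr (c - 1) / (1 + norm (w - a) powr (2 * c))))"
proof -
  have "P \<noteq> {}"
  proof
    assume "P = {}"
    then have "c \<le> -1" using total by simp
    then show False using c by simp
  qed
  \<comment> \<open>Points of the set are at least twice this far apart, so all of them but the nearest are at least this far from \<open>w\<close>.\<close>
  have "\<exists>\<delta>>0. \<delta> \<le> 1 \<and> (\<forall>a\<in>P. \<forall>b\<in>P. a \<noteq> b \<longrightarrow> 2 * \<delta> \<le> dist a b)"
  proof -
    define X where "X = insert 1 ((\<lambda>(a, b). dist a b / 2) ` {(a, b) \<in> P \<times> P. a \<noteq> b})"
    have "finite {(a, b) \<in> P \<times> P. a \<noteq> b}"
      by (rule finite_subset[of _ "P \<times> P"]) (use P in auto)
    then have "finite X" by (simp add: X_def)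
    moreover have "Min X > 0"
    proof -
      have "x > 0" if "x \<in> X" for x using that by (auto simp: X_def)
      moreover have "X \<noteq> {}" by (simp add: X_def)
      ultimately show ?thesis using \<open>finite X\<close> by simp
    qed
    moreover have "2 * Min X \<le> dist a b" if "a \<in> P" "b \<in> P" "a \<noteq> b" for a b
    proof -
      have "dist a b / 2 \<in> X" unfolding X_def using that by auto
      then have "Min X \<le> dist a b / 2" by (rule Min_le[OF \<open>finite X\<close>])
      then show ?thesis by simp
    qed
    moreover have "Min X \<le> 1"
      by (rule Min_le[OF \<open>finite X\<close>]) (simp add: X_def)
    ultimately show ?thesis by (intro exI[of _ "Min X"]) simp
  qed
  then obtain \<delta> where \<delta>: "\<delta> > 0" "\<delta> \<le> 1" "\<And>a b. a \<in> P \<Longrightarrow> b \<in> P \<Longrightarrow> a \<noteq> b \<Longrightarrow> 2 * \<delta> \<le> dist a b"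
    by auto
  define D where "D = diameter P"
  have D: "\<And>a b. a \<in> P \<Longrightarrow> b \<in> P \<Longrightarrow> dist a b \<le> D" "D \<ge> 0"
    using diameter_bounded_bound[OF finite_imp_bounded[OF P]] diameter_ge_0[OF finite_imp_bounded[OF P]]
    by (auto simp: D_def)
  \<comment> \<open>A common bound for the factors \<open>1 + norm (w - b) powr (2 * c)\<close>: as it stands if \<open>w\<close> is within distance \<open>1\<close> of \<open>P\<close>, and after division by \<open>t powr (2 * c)\<close> if the distance \<open>t\<close> is larger.\<close>
  define E where "E = 1 + (1 + D) powr (2 * c)"
  have "(1 + D) powr (2 * c) \<ge> 1" using D c by (intro ge_one_powr_ge_zero) auto
  then have E: "E \<ge> 2" by (simp add: E_def)
  define K where "K = (E / \<delta>) ^ card P * E"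
  have "K > 0" using E \<delta> by (simp add: K_def)
  moreover have "\<exists>a\<in>P. (\<Prod>b\<in>P. (1 + norm (w - b) powr (2 * c)) * norm (w - b) powr (- \<beta> b))
        \<le> K * (norm (w - a) powr (c - 1) / (1 + norm (w - a) powr (2 * c)))" if w: "w \<notin> P" for w
  proof -
    obtain a where a: "a \<in> P" "\<And>b. b \<in> P \<Longrightarrow> norm (w - a) \<le> norm (w - b)"
      using arg_min_if_finite[OF P \<open>P \<noteq> {}\<close>, of "\<lambda>b. norm (w - b)"] by (metis linorder_not_less)
    define t where "t = norm (w - a)"
    define F where "F b = (1 + norm (w - b) powr (2 * c)) * norm (w - b) powr (- \<beta> b)" for b
    have t: "t > 0" using a w by (auto simp: t_def)
    have up: "norm (w - b) \<le> t + D" if "b \<in> P" for b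
      using D(1)[OF a(1) that] norm_triangle_ineq[of "w - a" "a - b"]
      by (simp add: t_def dist_norm)
    have low: "t \<le> norm (w - b)" if "b \<in> P" for b
      using a(2)[OF that] by (simp add: t_def)
    have away: "\<delta> \<le> norm (w - b)" if "b \<in> P" "b \<noteq> a" for b
      using \<delta>(3)[OF a(1) that(1)] that(2) low[OF that(1)] norm_triangle_ineq4[of "w - b" "w - a"]
      by (simp add: t_def dist_norm)
    have "(\<Prod>b\<in>P. F b) \<le> K * (t powr (c - 1) / (1 + t powr (2 * c)))"
    proof (cases "t \<le> 1")
      case True
      have "(\<Prod>b\<in>P. F b) \<le> (\<Prod>b\<in>P. (E / \<delta>) * (if b = a then t powr (c - 1) else 1))"
      proof (rule prod_mono, safe)
        fix b assume b: "b \<in> P"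
        show "0 \<le> F b" by (simp add: F_def)
        have "1 + norm (w - b) powr (2 * c) \<le> E"
          using up[OF b] True c unfolding E_def by (intro add_left_mono powr_mono2) auto
        moreover have "norm (w - b) powr (- \<beta> b) \<le> 1 / \<delta> * (if b = a then t powr (c - 1) else 1)"
        proof (cases "b = a")
          case True
          have "t powr (- \<beta> a) \<le> t powr (c - 1)"
            using \<beta>[OF a(1)] t \<open>t \<le> 1\<close> by (intro powr_mono') auto
          also have "\<dots> \<le> 1 / \<delta> * t powr (c - 1)"
            using \<delta> mult_right_mono[of 1 "1 / \<delta>" "t powr (c - 1)"] by simp
          finally show ?thesis using True by (simp add: t_def)
        next
          case False
          have "norm (w - b) powr (- \<beta> b) \<le> \<delta> powr (- \<beta> b)"
            using away[OF b False] \<delta> \<beta>[OF b] by (intro powr_mono2') auto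
          also have "\<dots> \<le> \<delta> powr (- 1)"
            using \<delta> \<beta>[OF b] c by (intro powr_mono') auto
          also have "\<dots> = 1 / \<delta>" using \<delta> by (simp add: powr_minus_divide)
          finally show ?thesis using False by simp
        qed
        ultimately have "F b \<le> E * (1 / \<delta> * (if b = a then t powr (c - 1) else 1))"
          unfolding F_def using E by (intro mult_mono) auto
        then show "F b \<le> (E / \<delta>) * (if b = a then t powr (c - 1) else 1)" by simp
      qed
      also have "\<dots> = (E / \<delta>) ^ card P * t powr (c - 1)"
        using P a(1) by (simp only: prod.distrib prod.delta) simp
      also have "\<dots> = (E / \<delta>) ^ card P * (t powr (c - 1) / (1 + t powr (2 * c)) * (1 + t powr (2 * c)))"
        using powr_ge_zero[of t "2 * c"] by (simp add: add_nonneg_eq_0_iff)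
      also have "\<dots> \<le> (E / \<delta>) ^ card P * (t powr (c - 1) / (1 + t powr (2 * c)) * E)"
      proof -
        have "t powr (2 * c) \<le> 1" using True t c powr_mono2[of "2 * c" t 1] by simp
        then show ?thesis using E \<delta> by (intro mult_left_mono) auto
      qed
      finally show ?thesis by (simp add: K_def mult_ac)
    next
      case False
      then have t1: "t \<ge> 1" by simp
      have "(\<Prod>b\<in>P. F b) \<le> (\<Prod>b\<in>P. E * t powr (2 * c - \<beta> b))"
      proof (rule prod_mono, safe)
        fix b assume b: "b \<in> P"
        show "0 \<le> F b" by (simp add: F_def)
        have "norm (w - b) \<le> (1 + D) * t"
          using up[OF b] mult_left_mono[OF t1 D(2)] by (simp add: algebra_simps)
        then have "norm (w - b) powr (2 * c) \<le> ((1 + D) * t) powr (2 * c)"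
          using c by (intro powr_mono2) auto
        also have "\<dots> = (1 + D) powr (2 * c) * t powr (2 * c)"
          using D t by (simp add: powr_mult)
        finally have "1 + norm (w - b) powr (2 * c) \<le> 1 + (1 + D) powr (2 * c) * t powr (2 * c)" by simp
        also have "\<dots> \<le> E * t powr (2 * c)"
          using ge_one_powr_ge_zero[OF t1, of "2 * c"] c by (simp add: E_def algebra_simps)
        finally have "1 + norm (w - b) powr (2 * c) \<le> E * t powr (2 * c)" .
        moreover have "norm (w - b) powr (- \<beta> b) \<le> t powr (- \<beta> b)"
          using low[OF b] t \<beta>[OF b] by (intro powr_mono2') auto
        ultimately have "F b \<le> (E * t powr (2 * c)) * t powr (- \<beta> b)"
          unfolding F_def using E by (intro mult_mono) auto
        then show "F b \<le> E * t powr (2 * c - \<beta> b)"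
          by (simp add: powr_diff powr_minus_divide)
      qed
      also have "\<dots> = E ^ card P * t powr (2 * c * real (card P) - (\<Sum>b\<in>P. \<beta> b))"
        using t by (simp add: prod.distrib powr_sum[symmetric] P sum_subtractf mult_ac)
      also have "\<dots> \<le> (E / \<delta>) ^ card P * t powr (- 1 - c)"
      proof (intro mult_mono power_mono powr_mono)
        show "2 * c * real (card P) - (\<Sum>b\<in>P. \<beta> b) \<le> - 1 - c"
          using total by (simp add: algebra_simps)
        have "E * \<delta> \<le> E * 1" using E \<delta> by (intro mult_left_mono) auto
        then show "E \<le> E / \<delta>" using \<delta> by (simp add: field_simps)
      qed (use E \<delta> t1 in auto)
      also have "t powr (- 1 - c) \<le> E * (t powr (c - 1) / (1 + t powr (2 * c)))"
      proof -
        have "1 \<le> t powr (2 * c)" using t1 c by (intro ge_one_powr_ge_zero) auto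
        have "t powr (- 1 - c) * (1 + t powr (2 * c)) \<le> t powr (- 1 - c) * (E * t powr (2 * c))"
          using \<open>1 \<le> t powr (2 * c)\<close> E mult_right_mono[OF E, of "t powr (2 * c)"]
          by (intro mult_left_mono) auto
        also have "\<dots> = E * t powr (- 1 - c + 2 * c)"
          by (simp only: powr_add) simp
        also have "- 1 - c + 2 * c = c - 1" by simp
        finally show ?thesis using \<open>1 \<le> t powr (2 * c)\<close> by (simp add: field_simps)
      qed
      finally show ?thesis using E \<delta> by (simp add: K_def mult_ac mult_left_mono)
    qed
    then show ?thesis using a(1) unfolding F_def t_def by blast
  qed
  ultimately show ?thesis by blast
qed

section \<open>The defect relation for entire functions\<close>

text \<open>
  At a zero of \<open>f - a\<close> of order \<open>N\<close> the two factors have orders \<open>N - 1\<close> and \<open>- N * \<beta>\<close>. Choosing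
  \<open>\<beta>\<close> strictly below \<open>1 - 1 / N\<close> makes the sum of these positive, so that the pulled back density
  extends continuously by \<open>0\<close> without any regularity question at such points.
\<close>

lemma ramified_density_tendsto_0:
  fixes f :: "complex \<Rightarrow> complex" and \<beta> :: real
  assumes f: "f holomorphic_on UNIV" "\<not> f constant_on UNIV" and root: "f z1 = a"
    and ram: "(1 - \<beta>) * zorder (\<lambda>w. f w - a) z1 > 1"
  shows "((\<lambda>z. norm (deriv f z) * norm (f z - a) powr (- \<beta>)) \<longlongrightarrow> 0) (at z1)"
proof -
  define h where "h = (\<lambda>w. f w - a)"
  define g where "g = zor_poly h z1"
  define N where "N = nat (zorder h z1)"
  have "\<exists>w\<in>UNIV. h w \<noteq> 0"
    using f(2) unfolding constant_on_def h_def by auto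
  moreover have "h holomorphic_on UNIV" "h z1 = 0"
    using f(1) root by (auto simp: h_def intro!: holomorphic_intros)
  ultimately have "zorder h z1 > 0 \<and> (\<exists>r>0. cball z1 r \<subseteq> UNIV \<and> g holomorphic_on cball z1 r \<and>
      (\<forall>w\<in>cball z1 r. h w = g w * (w - z1) ^ N \<and> g w \<noteq> 0))"
    using zorder_exist_zero[of h UNIV z1, OF _ open_UNIV connected_UNIV] by (simp add: g_def N_def)
  then obtain r where zpos: "zorder h z1 > 0" and r: "r > 0" and g: "g holomorphic_on cball z1 r"
    and eq: "\<And>w. w \<in> cball z1 r \<Longrightarrow> h w = g w * (w - z1) ^ N \<and> g w \<noteq> 0"
    by blast
  have N: "N \<ge> 1" "(1 - \<beta>) * real N > 1"
    using zpos ram by (auto simp: N_def h_def)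
  define s where "s = real N - 1 - real N * \<beta>"
  have s: "s > 0" using N by (simp add: s_def algebra_simps)
  define M where "M w = norm (deriv g w * (w - z1) + of_nat N * g w) * norm (g w) powr (- \<beta>)" for w
  have gball: "g holomorphic_on ball z1 r"
    using g by (rule holomorphic_on_subset) auto
  have "isCont M z1"
  proof -
    have "isCont g z1" "isCont (deriv g) z1"
      using r holomorphic_on_imp_continuous_on[OF gball]
        holomorphic_on_imp_continuous_on[OF holomorphic_deriv[OF gball open_ball]]
      unfolding continuous_on_eq_continuous_at[OF open_ball] by auto
    moreover have "g z1 \<noteq> 0" using eq[of z1] r by auto
    ultimately show ?thesis unfolding M_def by (intro continuous_intros) auto
  qed
  then have M: "(M \<longlongrightarrow> M z1) (at z1)" by (simp add: isCont_def)
  have "((\<lambda>w. norm (w - z1) powr s * M w) \<longlongrightarrow> 0 * M z1) (at z1)"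
  proof (intro tendsto_intros M)
    show "((\<lambda>w. norm (w - z1) powr s) \<longlongrightarrow> 0) (at z1)"
      using s by (intro tendsto_zero_powrI[of _ _ _ s] tendsto_norm_zero) (auto intro!: LIM_zero)
  qed
  then have "((\<lambda>w. norm (w - z1) powr s * M w) \<longlongrightarrow> 0) (at z1)" by simp
  moreover have "eventually (\<lambda>w. norm (w - z1) powr s * M w
      = norm (deriv f w) * norm (f w - a) powr (- \<beta>)) (at z1)"
  proof -
    have "eventually (\<lambda>w. w \<in> ball z1 r - {z1}) (at z1)"
      using r by (intro eventually_at_in_open) auto
    then show ?thesis
    proof (rule eventually_mono)
      fix w assume w: "w \<in> ball z1 r - {z1}"
      have "(g has_field_derivative deriv g w) (at w)"
        using gball w by (intro holomorphic_derivI) auto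
      then have "((\<lambda>w. g w * (w - z1) ^ N) has_field_derivative
          (deriv g w * (w - z1) ^ N + of_nat N * (w - z1) ^ (N - 1) * g w)) (at w)"
        by (auto intro!: derivative_eq_intros)
      then have "(h has_field_derivative
          (deriv g w * (w - z1) ^ N + of_nat N * (w - z1) ^ (N - 1) * g w)) (at w)"
        by (rule has_field_derivative_transform_within_open[of _ _ _ "ball z1 r"]) (use w eq in auto)
      moreover have "(h has_field_derivative deriv f w) (at w)"
        unfolding h_def using holomorphic_derivI[OF f(1), of w] by (auto intro!: derivative_eq_intros)
      ultimately have "deriv f w = deriv g w * (w - z1) ^ N + of_nat N * (w - z1) ^ (N - 1) * g w"
        by (rule DERIV_unique[symmetric])
      also have "\<dots> = (w - z1) ^ (N - 1) * (deriv g w * (w - z1) + of_nat N * g w)"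
      proof -
        have "(w - z1) ^ N = (w - z1) ^ (N - 1) * (w - z1)"
          using N by (cases N) auto
        then show ?thesis by (simp only: distrib_left mult_ac)
      qed
      finally have 1: "norm (deriv f w)
          = norm (w - z1) powr real (N - 1) * norm (deriv g w * (w - z1) + of_nat N * g w)"
        using w by (simp add: norm_mult norm_power powr_realpow)
      have "norm (f w - a) = norm (g w) * norm (w - z1) powr real N"
        using eq[of w] w by (simp add: h_def norm_mult norm_power powr_realpow)
      then have 2: "norm (f w - a) powr (- \<beta>)
          = norm (g w) powr (- \<beta>) * norm (w - z1) powr (real N * (- \<beta>))"
        by (simp add: powr_mult powr_powr)
      have 3: "norm (w - z1) powr real (N - 1) * norm (w - z1) powr (real N * (- \<beta>)) = norm (w - z1) powr s"
        using N by (simp add: powr_add[symmetric] s_def of_nat_diff)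
      show "norm (w - z1) powr s * M w = norm (deriv f w) * norm (f w - a) powr (- \<beta>)"
        unfolding 1 2 3[symmetric] M_def by (simp add: mult_ac)
    qed
  qed
  ultimately show ?thesis by (rule Lim_transform_eventually)
qed

text \<open>
  At points with \<open>f z \<in> P\<close> this is \<open>0\<close>, by the convention \<open>0 powr x = 0\<close>, which is the
  continuous extension under the multiplicity hypotheses below.
\<close>

definition conical_pullback ::
  "complex set \<Rightarrow> (complex \<Rightarrow> real) \<Rightarrow> real \<Rightarrow> (complex \<Rightarrow> complex) \<Rightarrow> complex \<Rightarrow> real" where
  "conical_pullback P \<beta> c f z = norm (deriv f z) *
     (\<Prod>a\<in>P. (1 + norm (f z - a) powr (2 * c)) * norm (f z - a) powr (- \<beta> a))"

lemma conical_pullback_nonneg: "conical_pullback P \<beta> c f z \<ge> 0"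
  by (auto simp: conical_pullback_def intro!: mult_nonneg_nonneg prod_nonneg)

lemma isCont_conical_pullback:
  fixes f :: "complex \<Rightarrow> complex" and \<beta> :: "complex \<Rightarrow> real"
  assumes f: "f holomorphic_on UNIV" "\<not> f constant_on UNIV" and P: "finite P" and c: "c > 0"
    and ram: "\<And>a z. a \<in> P \<Longrightarrow> f z = a \<Longrightarrow> (1 - \<beta> a) * zorder (\<lambda>w. f w - a) z > 1"
  shows "isCont (conical_pullback P \<beta> c f) z1"
proof -
  have cf: "isCont f z1" and cf': "isCont (deriv f) z1"
    using f(1) holomorphic_deriv[OF f(1) open_UNIV]
    by (auto dest!: holomorphic_on_imp_continuous_on simp: continuous_on_eq_continuous_at)
  have A: "isCont (\<lambda>z. 1 + norm (f z - b) powr (2 * c)) z1" for b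
  proof -
    have "((\<lambda>z. norm (f z - b)) \<longlongrightarrow> norm (f z1 - b)) (at z1)"
      using cf unfolding isCont_def by (intro tendsto_intros)
    then have "((\<lambda>z. norm (f z - b) powr (2 * c)) \<longlongrightarrow> norm (f z1 - b) powr (2 * c)) (at z1)"
      by (rule tendsto_powr2) (use c in auto)
    then show ?thesis unfolding isCont_def by (intro tendsto_add tendsto_const)
  qed
  have B: "isCont (\<lambda>z. norm (f z - b) powr (- \<beta> b)) z1" if "f z1 \<noteq> b" for b
    using cf that by (intro continuous_intros) auto
  show ?thesis
  proof (cases "f z1 \<in> P")
    case False
    show ?thesis unfolding conical_pullback_def
      using False cf' by (intro continuous_intros A B) auto
  next
    case True
    define a where "a = f z1"
    have a: "a \<in> P" using True by (simp add: a_def)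
    define u1 where "u1 z = norm (deriv f z) * norm (f z - a) powr (- \<beta> a)" for z
    define u2 where "u2 z = (1 + norm (f z - a) powr (2 * c)) *
      (\<Prod>b\<in>P - {a}. (1 + norm (f z - b) powr (2 * c)) * norm (f z - b) powr (- \<beta> b))" for z
    have eq: "conical_pullback P \<beta> c f = (\<lambda>z. u1 z * u2 z)"
      unfolding conical_pullback_def u1_def u2_def prod.remove[OF P a] by (auto simp: mult_ac)
    have "isCont u1 z1"
      unfolding isCont_def u1_def
      using ramified_density_tendsto_0[OF f _ ram[OF a]] by (simp add: a_def)
    moreover have "isCont u2 z1"
      unfolding u2_def by (intro continuous_intros A B) (auto simp: a_def)
    ultimately show ?thesis unfolding eq by (intro continuous_intros)
  qed
qed

text \<open>
  With \<open>g0\<close> the value of \<open>g\<close> at a point, this writes \<open>1 + (norm g)\<^sup>2\<close> as the squared modulus of a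
  holomorphic function times a factor that has its minimum at this point. It expresses the
  invariance of the spherical metric under rotations of the sphere;
  \<open>disc_norm_square_identity\<close> is its counterpart for automorphisms of the disc.
\<close>

lemma one_plus_norm_square_identity:
  fixes g g0 :: complex
  assumes "1 + cnj g0 * g \<noteq> 0"
  shows "(1 + (norm g0)\<^sup>2) * (1 + (norm g)\<^sup>2)
    = (norm (1 + cnj g0 * g))\<^sup>2 * (1 + (norm ((g - g0) / (1 + cnj g0 * g)))\<^sup>2)"
proof -
  have "(norm (1 + cnj g0 * g))\<^sup>2 + (norm (g - g0))\<^sup>2 = (1 + (norm g0)\<^sup>2) * (1 + (norm g)\<^sup>2)"
    unfolding cmod_power2 by (simp add: power2_eq_square algebra_simps)
  then show ?thesis using assms by (simp add: norm_divide power_divide field_simps)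
qed

lemma disc_norm_square_identity:
  fixes z z0 :: complex and R :: real
  assumes "of_real (R\<^sup>2) - cnj z0 * z \<noteq> 0"
  shows "(R\<^sup>2 - (norm z0)\<^sup>2) * (R\<^sup>2 - (norm z)\<^sup>2)
    = (norm (of_real (R\<^sup>2) - cnj z0 * z))\<^sup>2 * (1 - (norm (of_real R * (z - z0) / (of_real (R\<^sup>2) - cnj z0 * z)))\<^sup>2)"
proof -
  have "(norm (of_real (R\<^sup>2) - cnj z0 * z))\<^sup>2 - R\<^sup>2 * (norm (z - z0))\<^sup>2 = (R\<^sup>2 - (norm z0)\<^sup>2) * (R\<^sup>2 - (norm z)\<^sup>2)"
    unfolding cmod_power2 by (simp add: power2_eq_square algebra_simps)
  moreover have "(norm (of_real R * (z - z0) / (of_real (R\<^sup>2) - cnj z0 * z)))\<^sup>2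
      = R\<^sup>2 * (norm (z - z0))\<^sup>2 / (norm (of_real (R\<^sup>2) - cnj z0 * z))\<^sup>2"
    by (simp add: norm_divide norm_mult power_divide power_mult_distrib)
  moreover have "(norm (of_real (R\<^sup>2) - cnj z0 * z))\<^sup>2 \<noteq> 0"
    using assms by simp
  ultimately show ?thesis by (simp add: right_diff_distrib del: of_real_power)
qed

lemma has_field_derivative_divide_zero:
  assumes "(u has_field_derivative u') (at x)" "(v has_field_derivative v') (at x)"
    and "u x = 0" "v x \<noteq> 0"
  shows "((\<lambda>z. u z / v z) has_field_derivative u' / v x) (at x)"
  using DERIV_divide[OF assms(1,2,4)] assms(3,4) by simp

text \<open>
  Near the maximum the functions \<open>f - b\<close> have logarithms \<open>L b\<close>, so \<open>norm (f z - b) powr x\<close> is the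
  modulus of the holomorphic function \<open>exp (x * L b z)\<close>, and \<open>1 + norm (f z - b) powr (2 * c)\<close> is
  \<open>1 + (norm (g b z))\<^sup>2\<close> with \<open>g b\<close> holomorphic. The two norm identities then bring the maximised
  quantity, up to the constant \<open>C\<close>, into the form treated in
  \<open>derivative_comparison_at_maximum\<close>, and the derivatives of \<open>q a\<close> and \<open>p\<close> at the maximum are the two
  sides of the claim.
\<close>

lemma conical_pullback_at_maximum:
  fixes f :: "complex \<Rightarrow> complex" and \<beta> :: "complex \<Rightarrow> real"
  assumes f: "f holomorphic_on UNIV" and P: "finite P" and c: "c > 0"
    and z0: "norm z0 < R" and pos: "conical_pullback P \<beta> c f z0 > 0"
    and max: "\<And>z. norm z < R \<Longrightarrow> conical_pullback P \<beta> c f z * (R\<^sup>2 - (norm z)\<^sup>2)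
        \<le> conical_pullback P \<beta> c f z0 * (R\<^sup>2 - (norm z0)\<^sup>2)"
    and a: "a \<in> P"
  shows "c * norm (deriv f z0) * (norm (f z0 - a) powr (c - 1) / (1 + norm (f z0 - a) powr (2 * c)))
    \<le> R / (R\<^sup>2 - (norm z0)\<^sup>2)"
proof -
  let ?u = "conical_pullback P \<beta> c f"
  have R: "R > 0" using z0 norm_ge_zero[of z0] by linarith
  have R2: "R\<^sup>2 - (norm z0)\<^sup>2 > 0" using z0 by (simp add: power_strict_mono)
  have f'0: "deriv f z0 \<noteq> 0" using pos by (auto simp: conical_pullback_def)
  have fP: "f z0 \<notin> P"
  proof
    assume "f z0 \<in> P"
    then have "?u z0 = 0" using P by (auto simp: conical_pullback_def intro!: prod_zero)
    then show False using pos by simp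
  qed
  have "open (ball 0 R \<inter> f -` (- P))"
    using holomorphic_on_imp_continuous_on[OF f] finite_imp_closed[OF P]
    by (intro open_Int open_ball open_vimage) auto
  moreover have "z0 \<in> ball 0 R \<inter> f -` (- P)" using z0 fP by simp
  ultimately obtain e where e: "e > 0" "ball z0 e \<subseteq> ball 0 R \<inter> f -` (- P)"
    using open_contains_ball by blast
  have "\<exists>L. L holomorphic_on ball z0 e \<and> (\<forall>z\<in>ball z0 e. exp (L z) = f z - b)" if "b \<in> P" for b
  proof -
    have "f z - b \<noteq> 0" if "z \<in> ball z0 e" for z using e(2) that \<open>b \<in> P\<close> by auto
    moreover have "(\<lambda>z. f z - b) holomorphic_on ball z0 e"
      using f by (intro holomorphic_intros holomorphic_on_subset[OF f]) auto
    ultimately obtain L where "L holomorphic_on ball z0 e" "\<And>z. z \<in> ball z0 e \<Longrightarrow> exp (L z) = f z - b"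
      using holomorphic_logarithm_exists[of "ball z0 e" "\<lambda>z. f z - b" z0] e(1)
      by (metis convex_ball open_ball centre_in_ball)
    then show ?thesis by blast
  qed
  then obtain L where L: "\<And>b. b \<in> P \<Longrightarrow> L b holomorphic_on ball z0 e"
    and expL: "\<And>b z. b \<in> P \<Longrightarrow> z \<in> ball z0 e \<Longrightarrow> exp (L b z) = f z - b"
    by metis
  define g where "g b z = exp (of_real c * L b z)" for b z
  have norm_exp: "norm (exp (of_real x * L b z)) = norm (f z - b) powr x"
    if "b \<in> P" "z \<in> ball z0 e" for b z x
    using expL[OF that, symmetric] by (simp add: powr_def)
  define q where "q b z = (g b z - g b z0) / (1 + cnj (g b z0) * g b z)" for b z
  define p where "p z = of_real R * (z - z0) / (of_real (R\<^sup>2) - cnj z0 * z)" for z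
  define H where "H z = deriv f z *
      (\<Prod>b\<in>P. (1 + cnj (g b z0) * g b z)\<^sup>2 * exp (of_real (- \<beta> b) * L b z)) * (of_real (R\<^sup>2) - cnj z0 * z)\<^sup>2" for z
  define C where "C = (\<Prod>b\<in>P. 1 + (norm (g b z0))\<^sup>2) * (R\<^sup>2 - (norm z0)\<^sup>2)"
  have C: "C > 0" unfolding C_def using R2
    by (intro mult_pos_pos prod_pos) (auto intro: add_pos_nonneg)
  have normg: "(norm (g b z))\<^sup>2 = norm (f z - b) powr (2 * c)" if "b \<in> P" "z \<in> ball z0 e" for b z
    using norm_exp[OF that, of c] powr_add[of "norm (f z - b)" c c] by (simp add: g_def power2_eq_square)
  have nzR: "of_real (R\<^sup>2) - cnj z0 * z \<noteq> 0" if "z \<in> ball z0 e" for z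
  proof
    assume "of_real (R\<^sup>2) - cnj z0 * z = 0"
    then have "norm (cnj z0 * z) = R\<^sup>2"
      by (metis eq_iff_diff_eq_0 norm_of_real abs_of_nonneg zero_le_power2)
    moreover have "norm z < R" using that e(2) by auto
    then have "norm (cnj z0 * z) < R * R"
      unfolding norm_mult using z0 by (intro mult_strict_mono') auto
    ultimately show False by (simp add: power2_eq_square)
  qed
  have factor: "C * (?u z * (R\<^sup>2 - (norm z)\<^sup>2))
      = norm (H z) * (\<Prod>b\<in>P. 1 + (norm (q b z))\<^sup>2) * (1 - (norm (p z))\<^sup>2)"
    if z: "z \<in> ball z0 e" and nz: "\<And>b. b \<in> P \<Longrightarrow> 1 + cnj (g b z0) * g b z \<noteq> 0" for z
  proof -
    have 1: "(1 + (norm (g b z0))\<^sup>2) * ((1 + norm (f z - b) powr (2 * c)) * norm (f z - b) powr (- \<beta> b))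
        = norm ((1 + cnj (g b z0) * g b z)\<^sup>2 * exp (of_real (- \<beta> b) * L b z)) * (1 + (norm (q b z))\<^sup>2)"
      if b: "b \<in> P" for b
    proof -
      have "(1 + (norm (g b z0))\<^sup>2) * (1 + (norm (g b z))\<^sup>2)
          = (norm (1 + cnj (g b z0) * g b z))\<^sup>2 * (1 + (norm (q b z))\<^sup>2)"
        unfolding q_def by (rule one_plus_norm_square_identity[OF nz[OF b]])
      then have "(1 + (norm (g b z0))\<^sup>2) * (1 + norm (f z - b) powr (2 * c)) * norm (f z - b) powr (- \<beta> b)
          = (norm (1 + cnj (g b z0) * g b z))\<^sup>2 * (1 + (norm (q b z))\<^sup>2) * norm (f z - b) powr (- \<beta> b)"
        unfolding normg[OF b z] by simp
      then show ?thesis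
        unfolding norm_mult norm_exp[OF b z] norm_power by (simp only: mult_ac)
    qed
    have 2: "(R\<^sup>2 - (norm z0)\<^sup>2) * (R\<^sup>2 - (norm z)\<^sup>2)
        = norm ((of_real (R\<^sup>2) - cnj z0 * z)\<^sup>2) * (1 - (norm (p z))\<^sup>2)"
      unfolding p_def norm_power
      using disc_norm_square_identity[of R z0 z] nzR[OF z] by simp
    have "C * (?u z * (R\<^sup>2 - (norm z)\<^sup>2))
      = norm (deriv f z) * (\<Prod>b\<in>P. (1 + (norm (g b z0))\<^sup>2) *
            ((1 + norm (f z - b) powr (2 * c)) * norm (f z - b) powr (- \<beta> b)))
          * ((R\<^sup>2 - (norm z0)\<^sup>2) * (R\<^sup>2 - (norm z)\<^sup>2))"
      unfolding C_def conical_pullback_def prod.distrib by (simp add: mult_ac)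
    also have "\<dots> = norm (deriv f z) * (\<Prod>b\<in>P.
            norm ((1 + cnj (g b z0) * g b z)\<^sup>2 * exp (of_real (- \<beta> b) * L b z)) * (1 + (norm (q b z))\<^sup>2))
          * (norm ((of_real (R\<^sup>2) - cnj z0 * z)\<^sup>2) * (1 - (norm (p z))\<^sup>2))"
      using 1 2 by (simp cong: prod.cong)
    also have "\<dots> = norm (H z) * (\<Prod>b\<in>P. 1 + (norm (q b z))\<^sup>2) * (1 - (norm (p z))\<^sup>2)"
      unfolding H_def norm_mult prod_norm[symmetric] prod.distrib by (simp add: mult_ac)
    finally show ?thesis .
  qed
  have z0e: "z0 \<in> ball z0 e" using e by simp
  have qp0: "q b z0 = 0" "p z0 = 0" for b by (simp_all add: q_def p_def)
  have nz0: "1 + cnj (g b z0) * g b z0 = of_real (1 + (norm (g b z0))\<^sup>2)" for b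
    by (simp add: complex_norm_square mult.commute del: of_real_power)
  have nz0': "1 + cnj (g b z0) * g b z0 \<noteq> 0" for b
    unfolding nz0 of_real_eq_0_iff using zero_le_power2[of "norm (g b z0)"] by linarith
  have Hz0: "norm (H z0) = C * (?u z0 * (R\<^sup>2 - (norm z0)\<^sup>2))"
    using factor[OF z0e nz0'] by (simp add: qp0)
  have H0: "H z0 \<noteq> 0" using Hz0 C pos R2 by auto
  define q' where "q' b = of_real c * (deriv f z0 / (f z0 - b)) * g b z0 / of_real (1 + (norm (g b z0))\<^sup>2)" for b
  define p' where "p' = (of_real (R / (R\<^sup>2 - (norm z0)\<^sup>2)) :: complex)"
  have q': "(q b has_field_derivative q' b) (at z0)" if b: "b \<in> P" for b
  proof -
    have fb: "f z0 - b \<noteq> 0" using b fP by auto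
    have "(L b has_field_derivative deriv (L b) z0) (at z0)"
      using L[OF b] e(1) by (intro holomorphic_derivI[OF _ open_ball]) auto
    then have L': "((\<lambda>z. exp (L b z)) has_field_derivative exp (L b z0) * deriv (L b) z0) (at z0)"
      by (auto intro!: derivative_eq_intros)
    have "((\<lambda>z. f z - b) has_field_derivative deriv f z0) (at z0)"
      using holomorphic_derivI[OF f, of z0] by (auto intro!: derivative_eq_intros)
    then have "((\<lambda>z. exp (L b z)) has_field_derivative deriv f z0) (at z0)"
      by (rule has_field_derivative_transform_within_open[of _ _ _ "ball z0 e"]) (use e(1) expL[OF b] in auto)
    from DERIV_unique[OF L' this] have "deriv (L b) z0 = deriv f z0 / (f z0 - b)"
      using fb expL[OF b z0e] by (simp add: field_simps)
    then have g': "(g b has_field_derivative of_real c * (deriv f z0 / (f z0 - b)) * g b z0) (at z0)"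
      unfolding g_def using \<open>(L b has_field_derivative deriv (L b) z0) (at z0)\<close>
      by (auto intro!: derivative_eq_intros)
    have "((\<lambda>z. (g b z - g b z0) / (1 + cnj (g b z0) * g b z)) has_field_derivative
        of_real c * (deriv f z0 / (f z0 - b)) * g b z0 / (1 + cnj (g b z0) * g b z0)) (at z0)"
    proof (rule has_field_derivative_divide_zero[where v = "\<lambda>z. 1 + cnj (g b z0) * g b z"])
      show "((\<lambda>z. g b z - g b z0) has_field_derivative
          of_real c * (deriv f z0 / (f z0 - b)) * g b z0) (at z0)"
        using DERIV_diff[OF g' DERIV_const[of "g b z0"]] by simp
      show "((\<lambda>z. 1 + cnj (g b z0) * g b z) has_field_derivative
          cnj (g b z0) * (of_real c * (deriv f z0 / (f z0 - b)) * g b z0)) (at z0)"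
        using DERIV_add[OF DERIV_const[of 1] DERIV_cmult[OF g', of "cnj (g b z0)"]] by simp
      show "1 + cnj (g b z0) * g b z0 \<noteq> 0" by (rule nz0')
    qed simp
    then show ?thesis unfolding q_def q'_def nz0 .
  qed
  have p': "(p has_field_derivative p') (at z0)"
  proof -
    have "of_real (R\<^sup>2) - cnj z0 * z0 = of_real (R\<^sup>2 - (norm z0)\<^sup>2)"
      by (simp add: complex_norm_square mult.commute del: of_real_power)
    then have p'_eq: "p' = of_real R / (of_real (R\<^sup>2) - cnj z0 * z0)"
      by (simp add: p'_def)
    show ?thesis
      unfolding p_def p'_eq
    proof (rule has_field_derivative_divide_zero[where v = "\<lambda>z. of_real (R\<^sup>2) - cnj z0 * z"])
      show "((\<lambda>z. of_real R * (z - z0)) has_field_derivative of_real R) (at z0)"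
        "((\<lambda>z. of_real (R\<^sup>2) - cnj z0 * z) has_field_derivative - cnj z0) (at z0)"
        by (auto intro!: derivative_eq_intros)
      show "of_real (R\<^sup>2) - cnj z0 * z0 \<noteq> 0" by (rule nzR[OF z0e])
    qed simp
  qed
  have "(\<Sum>b\<in>P. (norm (q' b))\<^sup>2) \<le> (norm p')\<^sup>2"
  proof (rule derivative_comparison_at_maximum[where q = q and p = p and H = H, OF P e(1) _ H0 _ _ p'])
    show "H holomorphic_on ball z0 e"
      unfolding H_def g_def using L f
      by (intro holomorphic_intros) (auto intro: holomorphic_on_subset)
  next
    fix z assume z: "z \<in> ball z0 e"
    show "norm (H z) * (\<Prod>b\<in>P. 1 + (norm (q b z))\<^sup>2) * (1 - (norm (p z))\<^sup>2) \<le> norm (H z0)"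
    \<comment> \<open>Where a denominator of some \<open>q b\<close> vanishes, so does \<open>H\<close>.\<close>
    proof (cases "\<forall>b\<in>P. 1 + cnj (g b z0) * g b z \<noteq> 0")
      case True
      have "?u z * (R\<^sup>2 - (norm z)\<^sup>2) \<le> ?u z0 * (R\<^sup>2 - (norm z0)\<^sup>2)"
        using z e(2) by (intro max) auto
      then show ?thesis
        using factor[OF z] True C unfolding Hz0 by (metis mult_left_mono less_imp_le)
    next
      case False
      then have "H z = 0" using P by (auto simp: H_def prod_zero_iff)
      then show ?thesis by simp
    qed
  qed (simp_all add: qp0 q')
  moreover have "(norm (q' a))\<^sup>2 \<le> (\<Sum>b\<in>P. (norm (q' b))\<^sup>2)"
    using P a by (intro member_le_sum) auto
  ultimately have "(norm (q' a))\<^sup>2 \<le> (norm p')\<^sup>2" by linarith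
  then have "norm (q' a) \<le> norm p'"
    by (rule power2_le_imp_le) simp
  also have "norm p' = R / (R\<^sup>2 - (norm z0)\<^sup>2)"
    unfolding p'_def norm_of_real using R R2 by simp
  also have "norm (q' a) = c * norm (deriv f z0) * (norm (f z0 - a) powr (c - 1) / (1 + norm (f z0 - a) powr (2 * c)))"
  proof -
    have fa: "norm (f z0 - a) > 0" using a fP by auto
    have "norm (g a z0) = norm (f z0 - a) powr c"
      unfolding g_def by (rule norm_exp[OF a z0e])
    also have "\<dots> = norm (f z0 - a) powr (c - 1) * norm (f z0 - a)"
      using fa by (simp add: powr_diff)
    finally have 1: "norm (g a z0) = norm (f z0 - a) powr (c - 1) * norm (f z0 - a)" .
    have 2: "norm (of_real (1 + (norm (g a z0))\<^sup>2) :: complex) = 1 + norm (f z0 - a) powr (2 * c)"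
      unfolding norm_of_real normg[OF a z0e] by simp
    show ?thesis
      unfolding q'_def norm_divide 2 unfolding norm_mult norm_divide 1 using fa c by simp
  qed
  finally show ?thesis .
qed

text \<open>
  The pullback times \<open>R\<^sup>2 - (norm z)\<^sup>2\<close> vanishes on the circle of radius \<open>R\<close>, hence has its maximum
  inside the disc, where \<open>conical_metric_bound\<close> and \<open>conical_pullback_at_maximum\<close> bound it by \<open>K / c * R\<close>. At a fixed point \<open>z'\<close>
  with positive density the product grows like \<open>R\<^sup>2\<close>, which is impossible for large \<open>R\<close>.
\<close>

theorem excess_ramification_impossible:
  fixes f :: "complex \<Rightarrow> complex" and \<beta> :: "complex \<Rightarrow> real"
  assumes f: "f holomorphic_on UNIV" "\<not> f constant_on UNIV" and P: "finite P"
    and \<beta>: "\<And>a. a \<in> P \<Longrightarrow> 0 \<le> \<beta> a \<and> \<beta> a < 1" and total: "(\<Sum>a\<in>P. \<beta> a) > 1"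
    and ram: "\<And>a z. a \<in> P \<Longrightarrow> f z = a \<Longrightarrow> (1 - \<beta> a) * zorder (\<lambda>w. f w - a) z > 1"
  shows False
proof -
  \<comment> \<open>The largest exponent that the metric bound permits.\<close>
  define C where "C = insert (((\<Sum>a\<in>P. \<beta> a) - 1) / (1 + 2 * real (card P))) ((\<lambda>a. 1 - \<beta> a) ` P)"
  define c where "c = Min C"
  have C: "finite C" "C \<noteq> {}" using P by (auto simp: C_def)
  have "c \<in> C" unfolding c_def by (rule Min_in[OF C])
  then have c: "c > 0" using \<beta> total by (auto simp: C_def intro!: divide_pos_pos)
  have "c \<le> 1 - \<beta> a" if "a \<in> P" for a
    unfolding c_def by (rule Min_le[OF C(1)]) (use that in \<open>auto simp: C_def\<close>)
  then have \<beta>c: "0 \<le> \<beta> a \<and> \<beta> a \<le> 1 - c" if "a \<in> P" for a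
    using \<beta> that by force
  have "c \<le> ((\<Sum>a\<in>P. \<beta> a) - 1) / (1 + 2 * real (card P))"
    unfolding c_def by (rule Min_le[OF C(1)]) (simp add: C_def)
  then have "c * (1 + 2 * real (card P)) \<le> (\<Sum>a\<in>P. \<beta> a) - 1"
    by (simp add: pos_le_divide_eq add_pos_nonneg)
  from conical_metric_bound[OF P c \<beta>c this] obtain K where K: "K > 0" and metric:
    "\<And>w. w \<notin> P \<Longrightarrow> \<exists>a\<in>P. (\<Prod>b\<in>P. (1 + norm (w - b) powr (2 * c)) * norm (w - b) powr (- \<beta> b))
        \<le> K * (norm (w - a) powr (c - 1) / (1 + norm (w - a) powr (2 * c)))"
    by auto
  let ?u = "conical_pullback P \<beta> c f"
  have cont: "continuous_on X ?u" for X
    by (intro continuous_at_imp_continuous_on ballI isCont_conical_pullback[OF f P c ram]) auto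
  have zero: "f z \<notin> P" if "?u z > 0" for z
  proof
    assume "f z \<in> P"
    then have "?u z = 0" using P by (auto simp: conical_pullback_def intro!: prod_zero)
    then show False using that by simp
  qed
  have "\<exists>z. ?u z > 0"
  proof (rule ccontr)
    assume none: "\<not> (\<exists>z. ?u z > 0)"
    have "\<exists>z. deriv f z \<noteq> 0"
    proof (rule ccontr)
      assume "\<not> (\<exists>z. deriv f z \<noteq> 0)"
      then have "(f has_field_derivative 0) (at z)" for z
        using holomorphic_derivI[OF f(1) open_UNIV, of z] by simp
      then have "\<exists>k. \<forall>z\<in>UNIV. f z = k"
        by (intro has_field_derivative_zero_constant) auto
      then show False using f(2) by (auto simp: constant_on_def)
    qed
    then obtain z1 where z1: "deriv f z1 \<noteq> 0" by blast
    have cont': "continuous_on UNIV (deriv f)"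
      by (intro holomorphic_on_imp_continuous_on holomorphic_deriv f open_UNIV)
    have "open (deriv f -` (- {0}))"
      by (intro open_vimage cont') auto
    then obtain e where e: "e > 0" "ball z1 e \<subseteq> deriv f -` (- {0})"
      using z1 open_contains_ball by (metis Compl_iff singletonD vimageI2)
    have "f z \<in> P" if "z \<in> ball z1 e" for z
    proof (rule ccontr)
      assume "f z \<notin> P"
      then have "?u z > 0"
        using e(2) that unfolding conical_pullback_def
        by (intro mult_pos_pos prod_pos) (auto intro: add_pos_nonneg)
      then show False using none by blast
    qed
    then have "finite (f ` ball z1 e)"
      using P by (meson finite_subset image_subsetI)
    then have "f constant_on ball z1 e"
      using holomorphic_on_imp_continuous_on[OF f(1)]
      by (intro continuous_finite_range_constant) (auto intro: continuous_on_subset)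
    then obtain k where k: "\<And>z. z \<in> ball z1 e \<Longrightarrow> f z = k"
      by (auto simp: constant_on_def)
    have "(f has_field_derivative 0) (at z1)"
      by (rule has_field_derivative_transform_within_open[of "\<lambda>_. k" _ _ "ball z1 e"]) (use e(1) k in auto)
    then show False using z1 DERIV_imp_deriv by blast
  qed
  then obtain z' where z': "?u z' > 0" by blast
  have bound: "?u z' * (R\<^sup>2 - (norm z')\<^sup>2) \<le> K / c * R" if R: "norm z' < R" for R
  proof -
    have R0: "R > 0" using R norm_ge_zero[of z'] by linarith
    have "continuous_on (cball 0 R) (\<lambda>z. ?u z * (R\<^sup>2 - (norm z)\<^sup>2))"
      by (intro continuous_intros cont)
    then obtain z0 where z0: "z0 \<in> cball 0 R"
      and max: "\<And>z. z \<in> cball 0 R \<Longrightarrow> ?u z * (R\<^sup>2 - (norm z)\<^sup>2) \<le> ?u z0 * (R\<^sup>2 - (norm z0)\<^sup>2)"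
      using continuous_attains_sup[OF compact_cball, of 0 R "\<lambda>z. ?u z * (R\<^sup>2 - (norm z)\<^sup>2)"] R0 by auto
    have "0 < ?u z' * (R\<^sup>2 - (norm z')\<^sup>2)"
      using z' R by (intro mult_pos_pos) (auto simp: power_strict_mono)
    also have le: "\<dots> \<le> ?u z0 * (R\<^sup>2 - (norm z0)\<^sup>2)"
      using R by (intro max) auto
    finally have pos: "0 < ?u z0 * (R\<^sup>2 - (norm z0)\<^sup>2)" .
    have "(norm z0)\<^sup>2 \<le> R\<^sup>2" using z0 by (intro power_mono) auto
    with pos conical_pullback_nonneg[of P \<beta> c f z0]
    have u0: "?u z0 > 0" and R2: "R\<^sup>2 - (norm z0)\<^sup>2 > 0"
      by (auto simp: zero_less_mult_iff)
    have "norm z0 < R" using R2 R0 by (simp add: power_less_imp_less_base)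
    obtain a where a: "a \<in> P" and le_a:
      "(\<Prod>b\<in>P. (1 + norm (f z0 - b) powr (2 * c)) * norm (f z0 - b) powr (- \<beta> b))
        \<le> K * (norm (f z0 - a) powr (c - 1) / (1 + norm (f z0 - a) powr (2 * c)))"
      using metric[OF zero[OF u0]] by blast
    have "c * ?u z0 \<le> c * (norm (deriv f z0) *
        (K * (norm (f z0 - a) powr (c - 1) / (1 + norm (f z0 - a) powr (2 * c)))))"
      unfolding conical_pullback_def using c le_a by (intro mult_left_mono) auto
    also have "\<dots> = K * (c * norm (deriv f z0) *
        (norm (f z0 - a) powr (c - 1) / (1 + norm (f z0 - a) powr (2 * c))))"
      by simp
    also have "\<dots> \<le> K * (R / (R\<^sup>2 - (norm z0)\<^sup>2))"
      using K max by (intro mult_left_mono conical_pullback_at_maximum[OF f(1) P c \<open>norm z0 < R\<close> u0 _ a]) auto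
    finally have "?u z0 * (R\<^sup>2 - (norm z0)\<^sup>2) \<le> K / c * R"
      using c R2 by (simp add: field_simps)
    with le show ?thesis by linarith
  qed
  define A where "A = ?u z'"
  define M where "M = K / c"
  \<comment> \<open>Any \<open>R \<ge> 2 * norm z'\<close> beyond \<open>2 * M / A\<close> contradicts the bound.\<close>
  define R where "R = 1 + 2 * norm z' + 2 * M / A"
  have A: "A > 0" and M: "M > 0" using z' K c by (simp_all add: A_def M_def)
  have "2 * M / A > 0" using A M by simp
  then have R: "norm z' < R" "2 * norm z' \<le> R" "R > 0" "R > 2 * M / A"
    using norm_ge_zero[of z'] unfolding R_def by linarith+
  have "(2 * norm z')\<^sup>2 \<le> R\<^sup>2" using R by (intro power_mono) auto
  then have "4 * (norm z')\<^sup>2 \<le> R\<^sup>2" by (simp add: power_mult_distrib)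
  then have "R\<^sup>2 / 2 \<le> R\<^sup>2 - (norm z')\<^sup>2" using zero_le_power2[of "norm z'"] by linarith
  then have "A * (R\<^sup>2 / 2) \<le> A * (R\<^sup>2 - (norm z')\<^sup>2)" using A by (intro mult_left_mono) auto
  also have "\<dots> \<le> M * R" using bound[OF R(1)] by (simp add: A_def M_def)
  finally have "A * R \<le> 2 * M" using R(3) by (simp add: power2_eq_square)
  then show False using R(4) A by (simp add: field_simps)
qed

text \<open>
  Scaling the numbers \<open>1 - 1 / m a\<close> by a factor \<open>\<theta> < 1\<close> that keeps their sum above \<open>1\<close> makes all
  multiplicity conditions strict, since \<open>(1 - \<theta> * (1 - 1 / m)) * m = 1 + (1 - \<theta>) * (m - 1)\<close>.
\<close>

theorem ramification_defect:
  fixes f :: "complex \<Rightarrow> complex" and m :: "complex \<Rightarrow> nat"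
  assumes f: "f holomorphic_on UNIV" "\<not> f constant_on UNIV" and P: "finite P"
    and m: "\<And>a. a \<in> P \<Longrightarrow> m a \<ge> 2"
    and ram: "\<And>a z. a \<in> P \<Longrightarrow> f z = a \<Longrightarrow> zorder (\<lambda>w. f w - a) z \<ge> int (m a)"
  shows "(\<Sum>a\<in>P. 1 - 1 / real (m a)) \<le> 1"
proof (rule ccontr)
  define S where "S = (\<Sum>a\<in>P. 1 - 1 / real (m a))"
  assume "\<not> (\<Sum>a\<in>P. 1 - 1 / real (m a)) \<le> 1"
  then have S: "S > 1" by (simp add: S_def)
  \<comment> \<open>The midpoint of \<open>1 / S\<close> and \<open>1\<close>.\<close>
  define \<theta> where "\<theta> = (1 + 1 / S) / 2"
  have \<theta>: "0 < \<theta>" "\<theta> < 1" "\<theta> * S > 1"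
    using S by (simp_all add: \<theta>_def field_simps)
  show False
  proof (rule excess_ramification_impossible[OF f P, where \<beta> = "\<lambda>a. \<theta> * (1 - 1 / real (m a))"])
    fix a assume a: "a \<in> P"
    have ma: "real (m a) \<ge> 2" using m[OF a] by simp
    have "\<theta> * (1 - 1 / real (m a)) \<le> \<theta> * 1" using \<theta> by (intro mult_left_mono) auto
    then show "0 \<le> \<theta> * (1 - 1 / real (m a)) \<and> \<theta> * (1 - 1 / real (m a)) < 1"
      using \<theta> ma by (intro conjI mult_nonneg_nonneg le_less_trans[OF _ \<theta>(2)]) auto
  next
    fix a z assume a: "a \<in> P" "f z = a"
    have ma: "real (m a) \<ge> 2" using m[OF a(1)] by simp
    have "1 < 1 + (1 - \<theta>) * (real (m a) - 1)" using \<theta> ma by (auto intro!: mult_pos_pos)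
    also have "\<dots> = (1 - \<theta> * (1 - 1 / real (m a))) * real (m a)" using ma by (simp add: field_simps)
    also have "\<dots> \<le> (1 - \<theta> * (1 - 1 / real (m a))) * real_of_int (zorder (\<lambda>w. f w - a) z)"
    proof (rule mult_left_mono)
      show "real (m a) \<le> real_of_int (zorder (\<lambda>w. f w - a) z)" using ram[OF a] by linarith
      have "\<theta> * (1 - 1 / real (m a)) \<le> \<theta> * 1" using \<theta> by (intro mult_left_mono) auto
      then show "0 \<le> 1 - \<theta> * (1 - 1 / real (m a))" using \<theta> by linarith
    qed
    finally show "(1 - \<theta> * (1 - 1 / real (m a))) * real_of_int (zorder (\<lambda>w. f w - a) z) > 1" .
  next
    show "(\<Sum>a\<in>P. \<theta> * (1 - 1 / real (m a))) > 1"
      using \<theta>(3) by (simp add: S_def sum_distrib_left)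
  qed
qed

section \<open>Triangular Toeplitz matrices\<close>

text \<open>
  This is multiplication by \<open>F\<close> on power series modulo \<open>X ^ k\<close>; a Jordan block is the case
  \<open>F = a + X\<close>. Sums, products and powers of such matrices are those of the series.
\<close>

definition toeplitz_mat :: "nat \<Rightarrow> 'a::comm_ring_1 fps \<Rightarrow> 'a mat" where
  "toeplitz_mat k F = Matrix.mat k k (\<lambda>(i, j). if i \<le> j then fps_nth F (j - i) else 0)"

lemma toeplitz_mat_carrier [simp]: "toeplitz_mat k F \<in> carrier_mat k k"
  by (simp add: toeplitz_mat_def)

lemma toeplitz_mat_dim [simp]: "dim_row (toeplitz_mat k F) = k" "dim_col (toeplitz_mat k F) = k"
  by (simp_all add: toeplitz_mat_def)

lemma toeplitz_mat_index [simp]: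
  "i < k \<Longrightarrow> j < k \<Longrightarrow> toeplitz_mat k F $$ (i, j) = (if i \<le> j then fps_nth F (j - i) else 0)"
  by (simp add: toeplitz_mat_def)

lemma toeplitz_mat_mult: "toeplitz_mat k F * toeplitz_mat k G = toeplitz_mat k (F * G)"
proof (rule eq_matI)
  fix i j assume "i < dim_row (toeplitz_mat k (F * G))" "j < dim_col (toeplitz_mat k (F * G))"
  then have i: "i < k" and j: "j < k" by auto
  have "row (toeplitz_mat k F) i \<bullet> col (toeplitz_mat k G) j
      = (\<Sum>l\<in>{0..<k}. (if i \<le> l then fps_nth F (l - i) else 0) * (if l \<le> j then fps_nth G (j - l) else 0))"
    unfolding Matrix.scalar_prod_def using i j by (intro sum.cong) auto
  also have "\<dots> = (\<Sum>l\<in>{i..j}. fps_nth F (l - i) * fps_nth G (j - l))"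
    using j by (intro sum.mono_neutral_cong_right) auto
  also have "\<dots> = (if i \<le> j then fps_nth (F * G) (j - i) else 0)"
  proof (cases "i \<le> j")
    case True
    have "(\<Sum>l\<in>{i..j}. fps_nth F (l - i) * fps_nth G (j - l))
        = (\<Sum>p\<in>{0..j-i}. fps_nth F p * fps_nth G (j - i - p))"
      by (rule sum.reindex_bij_witness[of _ "\<lambda>p. p + i" "\<lambda>l. l - i"]) (use True in auto)
    then show ?thesis using True by (simp add: fps_mult_nth)
  qed auto
  finally show "(toeplitz_mat k F * toeplitz_mat k G) $$ (i, j) = toeplitz_mat k (F * G) $$ (i, j)"
    using i j by simp
qed auto

lemma toeplitz_mat_pow: "toeplitz_mat k F ^\<^sub>m r = toeplitz_mat k (F ^ r)"
proof (induction r)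
  case 0
  show ?case by (rule eq_matI) (auto simp: fps_one_nth)
next
  case (Suc r)
  then show ?case by (simp add: toeplitz_mat_mult mult.commute)
qed

lemma fps_nth_power_below:
  fixes G :: "'a::comm_ring_1 fps"
  assumes "\<And>i. i < m \<Longrightarrow> fps_nth G i = 0" and "i < m * r"
  shows "fps_nth (G ^ r) i = 0"
  using assms(2)
proof (induction r arbitrary: i)
  case (Suc r)
  have "fps_nth G p * fps_nth (G ^ r) (i - p) = 0" if "p \<le> i" for p
  proof (cases "p < m")
    case False
    then have "i - p < m * r" using Suc.prems that by (simp add: algebra_simps)
    then show ?thesis using Suc.IH by simp
  qed (simp add: assms(1))
  then show ?case by (simp add: fps_mult_nth)
qed auto

lemma fps_nth_power_diag:
  fixes G :: "'a::comm_ring_1 fps"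
  assumes "fps_nth G 0 = 0"
  shows "fps_nth (G ^ r) r = fps_nth G 1 ^ r"
proof -
  have "G = fps_X * fps_shift 1 G"
    by (rule fps_ext) (use assms in \<open>auto simp: fps_X_mult_nth\<close>)
  then have "G ^ r = fps_X ^ r * fps_shift 1 G ^ r"
    by (metis power_mult_distrib)
  then show ?thesis by (simp add: fps_X_power_mult_nth fps_nth_power_0)
qed

lemma toeplitz_mat_char_matrix:
  "char_matrix (toeplitz_mat k F) a = toeplitz_mat k (F - fps_const (a::'a::field))"
  by (rule eq_matI) (auto simp: char_matrix_def)

lemma toeplitz_mat_eqI:
  "(\<And>i. i < k \<Longrightarrow> fps_nth F i = fps_nth G i) \<Longrightarrow> toeplitz_mat k F = toeplitz_mat k G"
  by (rule eq_matI) auto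

text \<open>
  With \<open>G = F - F 0\<close> of order exactly \<open>1\<close>, the last basis vector is cyclic for the nilpotent part: its
  images under the powers of \<open>G\<close> form the triangular matrix \<open>P\<close> below, whose diagonal consists of
  powers of \<open>fps_nth F 1\<close>, and \<open>P\<close> conjugates the Toeplitz matrix into the Jordan block.
\<close>

lemma toeplitz_mat_similar_jordan_block:
  fixes F :: "'a::field fps"
  assumes F: "fps_nth F 1 \<noteq> 0"
  shows "similar_mat (toeplitz_mat k F) (jordan_block k (fps_nth F 0))"
proof -
  define a G where "a = fps_nth F 0" and "G = F - fps_const a"
  have G0: "fps_nth G 0 = 0" and G1: "fps_nth G 1 = fps_nth F 1" and FG: "F = fps_const a + G"
    by (simp_all add: G_def a_def)
  define P where "P = Matrix.mat k k (\<lambda>(i, j). fps_nth (G ^ (k - 1 - j)) (k - 1 - i))"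
  have P: "P \<in> carrier_mat k k" by (simp add: P_def)
  have below: "fps_nth (G ^ r) i = 0" if "i < r" for i r
    using fps_nth_power_below[of 1 G i r] G0 that by auto
  have eq: "toeplitz_mat k F * P = P * jordan_block k a"
  proof (rule eq_matI; (simp add: P_def; fail)?)
    fix i j assume "i < dim_row (P * jordan_block k a)" "j < dim_col (P * jordan_block k a)"
    then have i: "i < k" and j: "j < k" using P by auto
    have "(toeplitz_mat k F * P) $$ (i, j)
        = (\<Sum>l\<in>{0..<k}. (if i \<le> l then fps_nth F (l - i) else 0) * fps_nth (G ^ (k - 1 - j)) (k - 1 - l))"
      using i j by (auto simp: P_def Matrix.scalar_prod_def intro!: sum.cong)
    also have "\<dots> = (\<Sum>l\<in>{i..k-1}. fps_nth F (l - i) * fps_nth (G ^ (k - 1 - j)) (k - 1 - l))"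
      using i by (intro sum.mono_neutral_cong_right) auto
    also have "\<dots> = (\<Sum>p\<in>{0..k-1-i}. fps_nth F p * fps_nth (G ^ (k - 1 - j)) (k - 1 - i - p))"
      by (rule sum.reindex_bij_witness[of _ "\<lambda>p. p + i" "\<lambda>l. l - i"]) (use i in auto)
    also have "\<dots> = fps_nth (F * G ^ (k - 1 - j)) (k - 1 - i)"
      by (simp add: fps_mult_nth)
    also have "F * G ^ (k - 1 - j) = fps_const a * G ^ (k - 1 - j) + G ^ (k - j)"
    proof -
      have "k - j = Suc (k - 1 - j)" using j by simp
      then show ?thesis by (subst FG) (simp add: algebra_simps)
    qed
    also have "fps_nth \<dots> (k - 1 - i)
        = a * fps_nth (G ^ (k - 1 - j)) (k - 1 - i) + fps_nth (G ^ (k - j)) (k - 1 - i)"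
      by simp
    also have "fps_nth (G ^ (k - j)) (k - 1 - i) = (if j = 0 then 0 else P $$ (i, j - 1))"
      using i j below[of "k - 1 - i" k] by (auto simp: P_def)
    also have "a * fps_nth (G ^ (k - 1 - j)) (k - 1 - i) + (if j = 0 then 0 else P $$ (i, j - 1))
        = (\<Sum>l\<in>{j} \<union> (if j = 0 then {} else {j - 1}). P $$ (i, l) * jordan_block k a $$ (l, j))"
      using i j by (auto simp: P_def)
    also have "\<dots> = (\<Sum>l\<in>{0..<k}. P $$ (i, l) * jordan_block k a $$ (l, j))"
      using j by (intro sum.mono_neutral_left) (auto split: if_splits)
    also have "\<dots> = (P * jordan_block k a) $$ (i, j)"
      using i j P by (auto simp: Matrix.scalar_prod_def intro!: sum.cong)
    finally show "(toeplitz_mat k F * P) $$ (i, j) = (P * jordan_block k a) $$ (i, j)" .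
  qed
  have "Determinant.det P = prod_list (diag_mat P)"
    by (rule det_upper_triangular[OF _ P]) (auto simp: P_def below)
  also have "\<dots> \<noteq> 0"
    using F G1 by (auto simp: diag_mat_def P_def fps_nth_power_diag[OF G0])
  finally have "Determinant.det P \<noteq> 0" .
  then obtain Q where Q: "Q \<in> carrier_mat k k" "P * Q = 1\<^sub>m k" "Q * P = 1\<^sub>m k"
    using det_non_zero_imp_unit[OF P, of "()"] by (auto simp: Units_def ring_mat_def)
  have "toeplitz_mat k F = toeplitz_mat k F * (P * Q)"
    using Q by simp
  also have "\<dots> = P * jordan_block k a * Q"
    using eq P Q by (metis assoc_mult_mat toeplitz_mat_carrier)
  finally show ?thesis
    using P Q by (intro similar_matI[of _ _ P Q k]) (auto simp: a_def)
qed

lemma toeplitz_mat_char_poly: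
  "char_poly (toeplitz_mat k (F :: 'a::field fps)) = [:- fps_nth F 0, 1:] ^ k"
proof -
  have "char_poly (toeplitz_mat k F) = (\<Prod>a\<leftarrow>diag_mat (toeplitz_mat k F). [:- a, 1:])"
    by (rule char_poly_upper_triangular) auto
  also have "diag_mat (toeplitz_mat k F) = replicate k (fps_nth F 0)"
    by (auto simp: diag_mat_def intro!: nth_equalityI)
  finally show ?thesis by (simp add: map_replicate)
qed

lemma jordan_nf_toeplitz_mat_eigenvalue:
  assumes "jordan_nf (toeplitz_mat k (F :: 'a::field fps)) n_as" and "(l, a) \<in> set n_as"
  shows "a = fps_nth F 0" and "l \<ge> 1"
proof -
  show l: "l \<ge> 1"
    using assms unfolding jordan_nf_def by force
  have "l \<le> Polynomial.order a ([:- fps_nth F 0, 1:] ^ k)"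
    using jordan_nf_block_size_order_bound[OF assms] by (simp add: toeplitz_mat_char_poly)
  then have "poly ([:- fps_nth F 0, 1:] ^ k) a = 0"
    using l by (metis order_root not_one_le_zero order_0I le_zero_eq)
  then show "a = fps_nth F 0"
    by simp
qed

text \<open>
  The nilpotent part has order at least \<open>m\<close> as a power series, so its \<open>r\<close>-th power is already \<open>0\<close> in
  size \<open>k\<close>. From then on the dimensions of the generalised eigenspaces no longer grow, whereas a
  block longer than \<open>r\<close> would make them grow.
\<close>

lemma jordan_nf_toeplitz_mat_block_bound:
  fixes F :: "'a::field fps"
  assumes nf: "jordan_nf (toeplitz_mat k F) n_as" and mem: "(l, a) \<in> set n_as"
    and vanish: "\<And>i. 0 < i \<Longrightarrow> i < m \<Longrightarrow> fps_nth F i = 0" and r: "k \<le> m * r"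
  shows "l \<le> r"
proof -
  define T where "T = toeplitz_mat k F"
  have a: "a = fps_nth F 0"
    using jordan_nf_toeplitz_mat_eigenvalue[OF nf mem] by simp
  have "char_matrix T a ^\<^sub>m s = 0\<^sub>m k k" if "r \<le> s" for s
  proof -
    have "fps_nth ((F - fps_const a) ^ s) i = 0" if "i < k" for i
    proof (rule fps_nth_power_below[of m])
      show "i < m * s" using that r \<open>r \<le> s\<close> by (meson less_le_trans mult_le_mono2)
      show "fps_nth (F - fps_const a) j = 0" if "j < m" for j
        using vanish[of j] that a by (cases j) auto
    qed
    then have "toeplitz_mat k ((F - fps_const a) ^ s) = toeplitz_mat k 0"
      by (intro toeplitz_mat_eqI) auto
    also have "\<dots> = 0\<^sub>m k k" by (rule eq_matI) auto
    finally show ?thesis by (simp add: T_def toeplitz_mat_char_matrix toeplitz_mat_pow)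
  qed
  then have "dim_gen_eigenspace T a r = dim_gen_eigenspace T a (r + l)"
    by (simp add: dim_gen_eigenspace_def)
  then have sums: "(\<Sum>n\<leftarrow>map fst [(n, e)\<leftarrow>n_as. e = a]. min r n)
      = (\<Sum>n\<leftarrow>map fst [(n, e)\<leftarrow>n_as. e = a]. min (r + l) n)"
    using nf by (simp only: dim_gen_eigenspace[OF nf] T_def)
  have l: "l \<in> set (map fst [(n, e)\<leftarrow>n_as. e = a])"
    using mem by force
  have "min r l = min (r + l) l"
  proof (rule ccontr)
    assume ne: "min r l \<noteq> min (r + l) l"
    have "(\<Sum>n\<leftarrow>ns. min r n) < (\<Sum>n\<leftarrow>ns. min (r + l) n)" if "l \<in> set ns" for ns
      using that
    proof (induction ns)
      case (Cons n ns)
      have "(\<Sum>n\<leftarrow>ns. min r n) \<le> (\<Sum>n\<leftarrow>ns. min (r + l) n)"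
        by (rule sum_list_mono) auto
      then show ?case using Cons ne by (auto simp: min_def split: if_splits)
    qed auto
    from this[OF l] sums show False by simp
  qed
  then show ?thesis by auto
qed

lemma jordan_matrix_trivial_blocks:
  assumes "\<And>x. x \<in> set n_as \<Longrightarrow> x = (1, a)"
  shows "jordan_matrix n_as = a \<cdot>\<^sub>m (1\<^sub>m (length n_as) :: 'a::comm_ring_1 mat)"
  using assms
proof (induction n_as)
  case Nil
  show ?case by (rule eq_matI) (auto simp: jordan_matrix_def)
next
  case (Cons x n_as)
  then have x: "x = (1, a)" and IH: "jordan_matrix n_as = a \<cdot>\<^sub>m 1\<^sub>m (length n_as)" by auto
  have len: "sum_list (map fst n_as) = length n_as"
  proof -
    have "fst y = 1" if "y \<in> set n_as" for y using Cons.prems[of y] that by simp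
    then have "sum_list (map fst n_as) = sum_list (map (\<lambda>_. 1) n_as)"
      by (intro arg_cong[where f = sum_list] map_cong) auto
    then show ?thesis by (simp add: sum_list_triv)
  qed
  show ?case unfolding x jordan_matrix_Cons IH len
    by (rule eq_matI) (auto simp: four_block_mat_def Let_def)
qed

text \<open>
  All eigenvalues equal \<open>fps_nth F 0\<close>; if all blocks were trivial, the matrix would be similar to a
  scalar matrix and hence be one, but its entry in position \<open>(0, m)\<close> is not \<open>0\<close>.
\<close>

lemma jordan_nf_toeplitz_mat_nontrivial:
  fixes F :: "'a::field fps"
  assumes nf: "jordan_nf (toeplitz_mat k F) n_as" and m: "0 < m" "m < k" "fps_nth F m \<noteq> 0"
  shows "\<exists>l\<ge>2. (l, fps_nth F 0) \<in> set n_as"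
proof (rule ccontr)
  define a where "a = fps_nth F 0"
  assume contr: "\<not> (\<exists>l\<ge>2. (l, fps_nth F 0) \<in> set n_as)"
  have "x = (1, a)" if "x \<in> set n_as" for x
  proof -
    obtain l b where x: "x = (l, b)" by force
    with that have "b = a" "l \<ge> 1"
      using jordan_nf_toeplitz_mat_eigenvalue[OF nf] by (auto simp: a_def)
    moreover have "\<not> l \<ge> 2" using contr that \<open>b = a\<close> by (auto simp: x a_def)
    ultimately show ?thesis using x by simp
  qed
  then have J: "jordan_matrix n_as = a \<cdot>\<^sub>m 1\<^sub>m (length n_as)"
    by (rule jordan_matrix_trivial_blocks)
  from nf obtain P Q where w: "similar_mat_wit (toeplitz_mat k F) (jordan_matrix n_as) P Q"
    unfolding jordan_nf_def similar_mat_def by auto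
  note D = similar_mat_witD2[OF toeplitz_mat_carrier w]
  have "length n_as = k"
    using arg_cong[OF J, of dim_row] carrier_matD(1)[OF D(5)] by simp
  then have "toeplitz_mat k F = P * (a \<cdot>\<^sub>m 1\<^sub>m k) * Q" using D(3) by (simp add: J)
  also have "\<dots> = a \<cdot>\<^sub>m (P * Q)"
    using mult_smult_distrib[OF D(6) one_carrier_mat, of a] mult_smult_assoc_mat[OF D(6) D(7), of a] D(6)
    by simp
  also have "P * Q = 1\<^sub>m k" by (rule D(1))
  finally have "toeplitz_mat k F $$ (0, m) = (a \<cdot>\<^sub>m 1\<^sub>m k) $$ (0, m)" by simp
  then show False using m by simp
qed

section \<open>Entire functions of Jordan matrices\<close>

lemma entire_fps_conv_radius:
  assumes "f holomorphic_on UNIV"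
  shows "fps_conv_radius (fps_expansion f z) = \<infinity>"
proof -
  have "fps_conv_radius (fps_expansion f z) \<ge> \<infinity>"
    by (rule conv_radius_fps_expansion) (use assms in \<open>auto intro: holomorphic_on_subset\<close>)
  then show ?thesis by simp
qed

lemma fps_nth_fps_deriv_iterate:
  "fps_nth ((fps_deriv ^^ d) F) r = fact (r + d) / fact r * fps_nth (F :: complex fps) (r + d)"
proof (induction d arbitrary: r)
  case (Suc d)
  show ?case by (simp add: Suc.IH field_simps del: of_nat_Suc)
qed simp

text \<open>
  The left side is the series for an entry of the induced map at a Jordan block with eigenvalue \<open>z\<close>,
  at distance \<open>d\<close> from the diagonal. Differentiating the expansion at \<open>0\<close> termwise \<open>d\<close> times shows
  that it gives the Taylor coefficient of \<open>f\<close> at \<open>z\<close>.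
\<close>

lemma fps_expansion_recentre_sums:
  assumes f: "f holomorphic_on UNIV"
  shows "(\<lambda>r. fps_nth (fps_expansion f 0) r * (of_nat (r choose d) * z ^ (r - d)))
           sums fps_nth (fps_expansion f z) d"
proof -
  define F where "F = fps_expansion f 0"
  have f_eq: "f = eval_fps F"
  proof
    fix w :: complex
    have "f has_fps_expansion F"
      unfolding F_def by (rule has_fps_expansion_fps_expansion[of UNIV]) (use f in auto)
    moreover have "f holomorphic_on ball 0 (norm w + 1)"
      by (rule holomorphic_on_subset[OF f]) simp
    ultimately show "f w = eval_fps F w"
      using has_fps_expansion_imp_eval_fps_eq[of f F w "norm w + 1"] by simp
  qed
  have rad: "fps_conv_radius ((fps_deriv ^^ d) F) = \<infinity>" for d
  proof (induction d)
    case (Suc d)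
    then show ?case using fps_conv_radius_deriv[of "(fps_deriv ^^ d) F"] by simp
  qed (simp add: F_def entire_fps_conv_radius[OF f])
  have "(deriv ^^ d) f = eval_fps ((fps_deriv ^^ d) F)" for d
  proof (induction d)
    case (Suc d)
    have "deriv (eval_fps ((fps_deriv ^^ d) F)) w = eval_fps ((fps_deriv ^^ Suc d) F) w" for w
      using has_field_derivative_eval_fps[of w "(fps_deriv ^^ d) F" UNIV] rad
      by (auto intro!: DERIV_imp_deriv)
    then show ?case using Suc by auto
  qed (simp add: f_eq)
  then have "fps_nth (fps_expansion f z) d = eval_fps ((fps_deriv ^^ d) F) z / fact d"
    by (simp add: fps_expansion_def)
  moreover have "(\<lambda>r. fps_nth ((fps_deriv ^^ d) F) r * z ^ r) sums eval_fps ((fps_deriv ^^ d) F) z"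
    by (rule sums_eval_fps) (simp add: rad)
  ultimately have "(\<lambda>r. fps_nth ((fps_deriv ^^ d) F) r * z ^ r / fact d) sums fps_nth (fps_expansion f z) d"
    by (simp add: sums_divide)
  also have "(\<lambda>r. fps_nth ((fps_deriv ^^ d) F) r * z ^ r / fact d)
      = (\<lambda>r. fps_nth F (r + d) * (of_nat ((r + d) choose d) * z ^ (r + d - d)))"
    by (auto simp: fps_nth_fps_deriv_iterate binomial_fact mult_ac)
  finally have "(\<lambda>r. fps_nth F (r + d) * (of_nat ((r + d) choose d) * z ^ (r + d - d)))
      sums fps_nth (fps_expansion f z) d" .
  moreover have "(\<Sum>r<d. fps_nth F r * (of_nat (r choose d) * z ^ (r - d))) = 0"
    by (intro sum.neutral) (auto simp: binomial_eq_0)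
  ultimately show ?thesis
    using sums_iff_shift[of "\<lambda>r. fps_nth F r * (of_nat (r choose d) * z ^ (r - d))" d]
    by (simp add: F_def)
qed

lemma entire_mat_carrier [simp]: "A \<in> carrier_mat n n \<Longrightarrow> entire_mat f A \<in> carrier_mat n n"
  by (auto simp: entire_mat_def)

lemma entire_mat_sums:
  assumes "f holomorphic_on UNIV" and A: "A \<in> carrier_mat n n" and "i < n" "j < n"
  shows "(\<lambda>k. fps_nth (fps_expansion f 0) k * (A ^\<^sub>m k) $$ (i, j)) sums (entire_mat f A $$ (i, j))"
  using summable_norm_cancel[OF summable_entire_mat[OF assms]] assms
  by (auto simp: entire_mat_def summable_sums)

lemma entire_mat_similar_wit:
  assumes f: "f holomorphic_on UNIV" and A: "A \<in> carrier_mat n n" and w: "similar_mat_wit A B P Q"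
  shows "similar_mat_wit (entire_mat f A) (entire_mat f B) P Q"
proof -
  note D = similar_mat_witD2[OF A w]
  have entry: "(P * M * Q) $$ (i, j) = (\<Sum>m<n. (\<Sum>l<n. P $$ (i, l) * M $$ (l, m)) * Q $$ (m, j))"
    if "M \<in> carrier_mat n n" "i < n" "j < n" for M i j
    using D(6,7) that
    by (auto simp: Matrix.scalar_prod_def atLeast0LessThan simp del: assoc_mult_mat intro!: sum.cong)
  have "entire_mat f A = P * entire_mat f B * Q"
  proof (rule eq_matI)
    fix i j assume "i < dim_row (P * entire_mat f B * Q)" "j < dim_col (P * entire_mat f B * Q)"
    then have i: "i < n" and j: "j < n" using D by auto
    let ?a = "fps_nth (fps_expansion f 0)"
    have "(\<lambda>k. \<Sum>m<n. (\<Sum>l<n. P $$ (i, l) * (?a k * (B ^\<^sub>m k) $$ (l, m))) * Q $$ (m, j))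
        sums (\<Sum>m<n. (\<Sum>l<n. P $$ (i, l) * entire_mat f B $$ (l, m)) * Q $$ (m, j))"
      by (intro sums_sum sums_mult2 sums_mult entire_mat_sums[OF f D(5)]) auto
    also have "(\<lambda>k. \<Sum>m<n. (\<Sum>l<n. P $$ (i, l) * (?a k * (B ^\<^sub>m k) $$ (l, m))) * Q $$ (m, j))
        = (\<lambda>k. ?a k * (A ^\<^sub>m k) $$ (i, j))"
    proof
      fix k
      have "(A ^\<^sub>m k) $$ (i, j) = (\<Sum>m<n. (\<Sum>l<n. P $$ (i, l) * (B ^\<^sub>m k) $$ (l, m)) * Q $$ (m, j))"
        using similar_mat_wit_pow_id[OF w, of k] entry[OF pow_carrier_mat[OF D(5)] i j] by simp
      then show "(\<Sum>m<n. (\<Sum>l<n. P $$ (i, l) * (?a k * (B ^\<^sub>m k) $$ (l, m))) * Q $$ (m, j))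
          = ?a k * (A ^\<^sub>m k) $$ (i, j)"
        by (simp add: sum_distrib_left sum_distrib_right mult_ac)
    qed
    also have "(\<Sum>m<n. (\<Sum>l<n. P $$ (i, l) * entire_mat f B $$ (l, m)) * Q $$ (m, j))
        = (P * entire_mat f B * Q) $$ (i, j)"
      by (rule entry[symmetric]) (use D i j in auto)
    finally show "entire_mat f A $$ (i, j) = (P * entire_mat f B * Q) $$ (i, j)"
      by (rule sums_unique2[OF entire_mat_sums[OF f A i j]])
  qed (use A D in \<open>auto simp: entire_mat_def\<close>)
  then show ?thesis
    using A D by (intro similar_mat_witI[of _ _ n]) auto
qed

lemma entire_mat_jordan_block:
  assumes f: "f holomorphic_on UNIV"
  shows "entire_mat f (jordan_block k z) = toeplitz_mat k (fps_expansion f z)"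
proof (rule eq_matI)
  fix i j assume "i < dim_row (toeplitz_mat k (fps_expansion f z))"
    "j < dim_col (toeplitz_mat k (fps_expansion f z))"
  then have i: "i < k" and j: "j < k" by auto
  have s: "(\<lambda>r. fps_nth (fps_expansion f 0) r * (jordan_block k z ^\<^sub>m r) $$ (i, j))
      sums (entire_mat f (jordan_block k z) $$ (i, j))"
    by (rule entire_mat_sums[OF f jordan_block_carrier i j])
  show "entire_mat f (jordan_block k z) $$ (i, j) = toeplitz_mat k (fps_expansion f z) $$ (i, j)"
  proof (cases "i \<le> j")
    case True
    have "(jordan_block k z ^\<^sub>m r) $$ (i, j) = of_nat (r choose (j - i)) * z ^ (r - (j - i))" for r
      using True i j by (simp add: jordan_block_pow)
    then have "entire_mat f (jordan_block k z) $$ (i, j) = fps_nth (fps_expansion f z) (j - i)"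
      using s fps_expansion_recentre_sums[OF f, of "j - i" z] by (simp add: sums_unique2)
    then show ?thesis using True i j by simp
  next
    case False
    then have "(jordan_block k z ^\<^sub>m r) $$ (i, j) = 0" for r
      using i j by (simp add: jordan_block_pow)
    then have "entire_mat f (jordan_block k z) $$ (i, j) = 0"
      using s by (simp add: sums_0 sums_unique2)
    then show ?thesis using False i j by simp
  qed
qed (simp_all add: entire_mat_def)

lemma entire_mat_jordan_matrix:
  assumes f: "f holomorphic_on UNIV"
  shows "entire_mat f (jordan_matrix n_as)
    = diag_block_mat (map (\<lambda>(k, z). toeplitz_mat k (fps_expansion f z)) n_as)"
proof (induction n_as)
  case Nil
  show ?case by (rule eq_matI) (auto simp: entire_mat_def jordan_matrix_def)
next
  case (Cons x n_as)
  obtain k z where x: "x = (k, z)" by force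
  define m where "m = sum_list (map fst n_as)"
  let ?J = "jordan_block k z" and ?M = "jordan_matrix n_as"
  have M: "?M \<in> carrier_mat m m" by (simp add: m_def)
  have pow: "jordan_matrix ((k, z) # n_as) ^\<^sub>m r
      = four_block_mat (?J ^\<^sub>m r) (0\<^sub>m k m) (0\<^sub>m m k) (?M ^\<^sub>m r)" for r
  proof -
    have "dim_row (?M ^\<^sub>m r) = m" "dim_col (?M ^\<^sub>m r) = m"
      using pow_carrier_mat[OF M, of r] by auto
    then show ?thesis
      unfolding jordan_matrix_pow[of "(k, z) # n_as"] list.map prod.case diag_block_mat.simps
        jordan_matrix_pow[of n_as, symmetric] Let_def by simp
  qed
  have fM: "entire_mat f ?M \<in> carrier_mat m m" using M by simp
  have "entire_mat f (jordan_matrix ((k, z) # n_as))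
      = four_block_mat (entire_mat f ?J) (0\<^sub>m k m) (0\<^sub>m m k) (entire_mat f ?M)"
  proof (rule eq_matI)
    fix i j
    assume "i < dim_row (four_block_mat (entire_mat f ?J) (0\<^sub>m k m) (0\<^sub>m m k) (entire_mat f ?M))"
      and "j < dim_col (four_block_mat (entire_mat f ?J) (0\<^sub>m k m) (0\<^sub>m m k) (entire_mat f ?M))"
    then have "i < k + m" "j < k + m" by (simp_all add: entire_mat_def m_def)
    then show "entire_mat f (jordan_matrix ((k, z) # n_as)) $$ (i, j)
        = four_block_mat (entire_mat f ?J) (0\<^sub>m k m) (0\<^sub>m m k) (entire_mat f ?M) $$ (i, j)"
      by (cases "i < k"; cases "j < k") (simp_all add: entire_mat_def pow m_def[symmetric] cong: if_cong)
  qed (simp_all add: entire_mat_def m_def)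
  also have "\<dots> = diag_block_mat (map (\<lambda>(k, z). toeplitz_mat k (fps_expansion f z)) (x # n_as))"
    unfolding list.map x prod.case diag_block_mat.simps Cons.IH[symmetric] Let_def
      entire_mat_jordan_block[OF f] using fM by simp
  finally show ?case unfolding x .
qed

section \<open>The range on matrices\<close>

lemma coeff_below_zorder:
  assumes f: "f holomorphic_on UNIV" "\<not> f constant_on UNIV"
  shows "0 < i \<Longrightarrow> int i < zorder (\<lambda>w. f w - f z) z \<Longrightarrow> fps_nth (fps_expansion f z) i = 0"
    and "\<exists>m>0. zorder (\<lambda>w. f w - f z) z = int m \<and> fps_nth (fps_expansion f z) m \<noteq> 0"
proof -
  define G where "G = fps_expansion f z - fps_const (f z)"
  have G: "(\<lambda>w. f (z + w) - f z) has_fps_expansion G"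
  proof -
    have "f analytic_on {z}" using f(1) by (rule holomorphic_on_imp_analytic_at) auto
    then have "(\<lambda>w. f (z + w)) has_fps_expansion fps_expansion f z"
      by (rule analytic_at_imp_has_fps_expansion)
    then show ?thesis unfolding G_def by (intro fps_expansion_intros)
  qed
  have coeff: "fps_nth (fps_expansion f z) i = fps_nth G i" if "i > 0" for i
    using that by (simp add: G_def)
  have "G \<noteq> 0"
  proof
    assume "G = 0"
    then have "eventually (\<lambda>w. f (z + w) - f z = 0) (nhds 0)"
      using G by (simp add: has_fps_expansion_0_iff)
    then have "\<exists>e>0. \<forall>w. dist w 0 < e \<longrightarrow> f (z + w) - f z = 0"
      by (simp only: eventually_nhds_metric)
    then obtain e where e: "e > 0 \<and> (\<forall>w. dist w 0 < e \<longrightarrow> f (z + w) - f z = 0)"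
      by (rule exE)
    have near: "f w = f z" if "dist z w < e" for w
    proof -
      have "dist (w - z) 0 < e" using that by (simp add: dist_norm norm_minus_commute)
      then have "f (z + (w - z)) - f z = 0" using e by blast
      then show ?thesis by simp
    qed
    have "f w = f z" for w
    proof (rule analytic_continuation_open[of "ball z e" UNIV f "\<lambda>_. f z"])
      show "ball z e \<noteq> {}" using e by simp
      show "f v = f z" if "v \<in> ball z e" for v using near that by simp
    qed (use f(1) in auto)
    then show False using f(2) by (auto simp: constant_on_def)
  qed
  then have z: "zorder (\<lambda>w. f w - f z) z = int (subdegree G)"
    using has_fps_expansion_zorder[of "\<lambda>w. f w - f z" z G] G by simp
  show "fps_nth (fps_expansion f z) i = 0" if "0 < i" "int i < zorder (\<lambda>w. f w - f z) z"
    using that coeff[OF that(1)] z by (auto intro: nth_less_subdegree_zero)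
  have "fps_nth G 0 = 0" by (simp add: G_def fps_expansion_def)
  then have "subdegree G > 0" using \<open>G \<noteq> 0\<close> nth_subdegree_nonzero[of G] by (cases "subdegree G = 0") auto
  then show "\<exists>m>0. zorder (\<lambda>w. f w - f z) z = int m \<and> fps_nth (fps_expansion f z) m \<noteq> 0"
    using z coeff[of "subdegree G"] \<open>G \<noteq> 0\<close> by (intro exI[of _ "subdegree G"]) auto
qed

lemma fps_expansion_nth_0 [simp]: "fps_nth (fps_expansion f z) 0 = f z"
  by (simp add: fps_expansion_def)

lemma complex_jordan_nf_exists:
  assumes "(A :: complex mat) \<in> carrier_mat n n"
  shows "\<exists>n_as. jordan_nf A n_as"
proof -
  obtain as where "char_poly A = (\<Prod>a\<leftarrow>as. [:- a, 1:])"
    using char_poly_factorized[OF assms] by auto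
  then show ?thesis by (rule jordan_nf_exists[OF assms])
qed

lemma jordan_nf_block_size_le:
  assumes A: "(A :: complex mat) \<in> carrier_mat n n" and nf: "jordan_nf A n_as" and mem: "(k, a) \<in> set n_as"
  shows "k \<le> n"
proof -
  have "char_poly A \<noteq> 0" "degree (char_poly A) = n"
    using degree_monic_char_poly[OF A] by auto
  then show ?thesis
    using jordan_nf_block_size_order_bound[OF nf mem] order_degree[of "char_poly A" a] by simp
qed

text \<open>
  Solving \<open>f(X) = B\<close> on each Jordan block of \<open>B\<close> separately solves it for \<open>B\<close>: the map induced by \<open>f\<close>
  respects direct sums and conjugation.
\<close>

lemma mem_range_if_blocks_in_range:
  assumes f: "f holomorphic_on UNIV" and B: "B \<in> carrier_mat n n" and nf: "jordan_nf B n_as"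
    and sol: "\<And>k b. (k, b) \<in> set n_as \<Longrightarrow>
        \<exists>z. similar_mat (toeplitz_mat k (fps_expansion f z)) (jordan_block k b)"
  shows "B \<in> entire_mat f ` carrier_mat n n"
proof -
  obtain \<zeta> where \<zeta>: "\<And>k b. (k, b) \<in> set n_as \<Longrightarrow>
      similar_mat (toeplitz_mat k (fps_expansion f (\<zeta> k b))) (jordan_block k b)"
    using sol by metis
  define m_as where "m_as = map (\<lambda>(k, b). (k, \<zeta> k b)) n_as"
  define Ms where "Ms = map (\<lambda>(k, b). (toeplitz_mat k (fps_expansion f (\<zeta> k b)), jordan_block k b)) n_as"
  have "similar_mat (diag_block_mat (map fst Ms)) (diag_block_mat (map snd Ms))"
    by (rule similar_diag_mat_block_mat) (auto simp: Ms_def \<zeta>)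
  moreover have "diag_block_mat (map snd Ms) = jordan_matrix n_as"
    unfolding jordan_matrix_def Ms_def by (rule arg_cong[where f = diag_block_mat]) auto
  moreover have "diag_block_mat (map fst Ms) = entire_mat f (jordan_matrix m_as)"
    unfolding entire_mat_jordan_matrix[OF f] Ms_def m_as_def
    by (rule arg_cong[where f = diag_block_mat]) auto
  ultimately have sim: "similar_mat (entire_mat f (jordan_matrix m_as)) (jordan_matrix n_as)"
    by simp
  have "similar_mat B (jordan_matrix n_as)" using nf by (simp add: jordan_nf_def)
  then have "similar_mat B (entire_mat f (jordan_matrix m_as))"
    by (rule similar_mat_trans[OF _ similar_mat_sym[OF sim]])
  then obtain P Q where w: "similar_mat_wit B (entire_mat f (jordan_matrix m_as)) P Q"
    unfolding similar_mat_def by auto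
  note D = similar_mat_witD2[OF B w]
  have J: "jordan_matrix m_as \<in> carrier_mat n n"
  proof -
    have "dim_row (entire_mat f (jordan_matrix m_as)) = n" using D(5) by (rule carrier_matD(1))
    then have "sum_list (map fst m_as) = n" by (simp add: entire_mat_def)
    then show ?thesis using jordan_matrix_carrier[of m_as] by simp
  qed
  define A where "A = P * jordan_matrix m_as * Q"
  have A: "A \<in> carrier_mat n n" unfolding A_def using D J by auto
  have "similar_mat_wit A (jordan_matrix m_as) P Q"
    by (rule similar_mat_witI[OF D(1,2) A_def A J D(6,7)])
  from similar_mat_witD2(3)[OF _ entire_mat_similar_wit[OF f A this], of n n] A
  have "entire_mat f A = P * entire_mat f (jordan_matrix m_as) * Q" by simp
  also have "\<dots> = B" using D(3) by simp
  finally show ?thesis using A by blast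
qed

text \<open>
  Applying \<open>f\<close> to the Jordan form of \<open>A\<close> and then taking Jordan forms of the resulting Toeplitz
  matrices gives a Jordan form of \<open>f(A)\<close>; by uniqueness every block of \<open>f(A)\<close> occurs in one of
  them.
\<close>

lemma entire_mat_block_source:
  assumes f: "f holomorphic_on UNIV" and A: "A \<in> carrier_mat n n"
    and nf: "jordan_nf (entire_mat f A) n_as" and mem: "(l, b) \<in> set n_as"
  shows "\<exists>k z m_as. k \<le> n \<and> f z = b \<and> jordan_nf (toeplitz_mat k (fps_expansion f z)) m_as \<and> (l, b) \<in> set m_as"
proof -
  obtain k_zs where A_nf: "jordan_nf A k_zs"
    using complex_jordan_nf_exists[OF A] by blast
  have "\<exists>m_as. jordan_nf (toeplitz_mat k (fps_expansion f z)) m_as" for k z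
    by (rule complex_jordan_nf_exists[OF toeplitz_mat_carrier])
  then obtain \<mu> where \<mu>: "\<And>k z. jordan_nf (toeplitz_mat k (fps_expansion f z)) (\<mu> k z)"
    by metis
  define Ms where "Ms = map (\<lambda>(k, z). (toeplitz_mat k (fps_expansion f z), \<mu> k z)) k_zs"
  have Ms: "jordan_nf (diag_block_mat (map fst Ms)) (concat (map snd Ms))"
    by (rule jordan_nf_diag_block_mat) (auto simp: Ms_def \<mu>)
  have "diag_block_mat (map fst Ms) = entire_mat f (jordan_matrix k_zs)"
    unfolding entire_mat_jordan_matrix[OF f] Ms_def
    by (rule arg_cong[where f = diag_block_mat]) auto
  moreover obtain P Q where "similar_mat_wit A (jordan_matrix k_zs) P Q"
    using A_nf unfolding jordan_nf_def similar_mat_def by auto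
  then have "similar_mat (entire_mat f A) (entire_mat f (jordan_matrix k_zs))"
    using entire_mat_similar_wit[OF f A] unfolding similar_mat_def by blast
  ultimately have sim: "similar_mat (entire_mat f A) (diag_block_mat (map fst Ms))" by simp
  have "jordan_nf (entire_mat f A) (concat (map snd Ms))"
    using Ms similar_mat_trans[OF sim] by (simp add: jordan_nf_def)
  from jordan_nf_unique[OF nf this] mem have "(l, b) \<in> set (concat (map snd Ms))" by simp
  then obtain k z where kz: "(k, z) \<in> set k_zs" "(l, b) \<in> set (\<mu> k z)"
    unfolding Ms_def by auto
  have "b = f z"
    using jordan_nf_toeplitz_mat_eigenvalue(1)[OF \<mu> kz(2)] by simp
  moreover have "k \<le> n" by (rule jordan_nf_block_size_le[OF A A_nf kz(1)])
  ultimately show ?thesis using kz(2) \<mu> by blast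
qed

text \<open>
  The two uses are \<open>m = n, r = 1\<close>, where no nontrivial block at \<open>b\<close> survives, and
  \<open>m = 2, r = n - 1\<close>, where a full block of size \<open>n \<ge> 2\<close> cannot occur.
\<close>

lemma entire_mat_block_size_bound:
  assumes f: "f holomorphic_on UNIV" "\<not> f constant_on UNIV" and A: "A \<in> carrier_mat n n"
    and nf: "jordan_nf (entire_mat f A) n_as" and mem: "(l, b) \<in> set n_as"
    and ram: "\<And>z. f z = b \<Longrightarrow> zorder (\<lambda>w. f w - b) z \<ge> int m" and r: "n \<le> m * r"
  shows "l \<le> r"
proof -
  obtain k z m_as where *: "k \<le> n" "f z = b" "jordan_nf (toeplitz_mat k (fps_expansion f z)) m_as" "(l, b) \<in> set m_as"
    using entire_mat_block_source[OF f(1) A nf mem] by blast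
  show ?thesis
  proof (rule jordan_nf_toeplitz_mat_block_bound[OF *(3,4), of m])
    show "fps_nth (fps_expansion f z) i = 0" if "0 < i" "i < m" for i
    proof (rule coeff_below_zorder(1)[OF f that(1)])
      show "int i < zorder (\<lambda>w. f w - f z) z"
        unfolding *(2) using ram[OF *(2)] that(2) by linarith
    qed
    show "k \<le> m * r" using *(1) r by simp
  qed
qed

lemma nontrivial_block_mats_iff:
  assumes "jordan_nf B n_as" and "B \<in> carrier_mat n n"
  shows "B \<in> nontrivial_block_mats n a \<longleftrightarrow> (\<exists>k\<ge>2. (k, a) \<in> set n_as)"
proof
  assume "B \<in> nontrivial_block_mats n a"
  then obtain m_as k where "jordan_nf B m_as" "k \<ge> 2" "(k, a) \<in> set m_as"
    unfolding nontrivial_block_mats_def by auto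
  then show "\<exists>k\<ge>2. (k, a) \<in> set n_as"
    using jordan_nf_unique[OF assms(1)] by blast
qed (use assms in \<open>auto simp: nontrivial_block_mats_def\<close>)

text \<open>
  The witness is the image of the full Jordan block at the root \<open>z\<close>: its multiplicity being smaller
  than \<open>n\<close>, a Taylor coefficient above the diagonal survives.
\<close>

lemma range_meets_nontrivial_block_mats:
  assumes f: "f holomorphic_on UNIV" "\<not> f constant_on UNIV"
    and z: "f z = a" "2 \<le> zorder (\<lambda>w. f w - a) z" "zorder (\<lambda>w. f w - a) z < int n"
  shows "entire_mat f ` carrier_mat n n \<inter> nontrivial_block_mats n a \<noteq> {}"
proof -
  define B where "B = entire_mat f (jordan_block n z)"
  have B: "B \<in> carrier_mat n n" "B = toeplitz_mat n (fps_expansion f z)"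
    by (simp_all add: B_def entire_mat_jordan_block[OF f(1)])
  obtain n_as where nf: "jordan_nf B n_as" using complex_jordan_nf_exists[OF B(1)] by blast
  obtain m where m: "m > 0" "zorder (\<lambda>w. f w - a) z = int m" "fps_nth (fps_expansion f z) m \<noteq> 0"
    using coeff_below_zorder(2)[OF f, of z] z(1) by auto
  have "\<exists>l\<ge>2. (l, fps_nth (fps_expansion f z) 0) \<in> set n_as"
    using jordan_nf_toeplitz_mat_nontrivial[of n "fps_expansion f z" n_as m] nf B(2) m z(3) by simp
  then have "B \<in> nontrivial_block_mats n a"
    using nontrivial_block_mats_iff[OF nf B(1)] z(1) by simp
  then show ?thesis
    using imageI[OF jordan_block_carrier[of n z], of "entire_mat f"] unfolding B_def by blast
qed

lemma nontrivial_block_mats_disjoint_range: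
  assumes f: "f holomorphic_on UNIV" "\<not> f constant_on UNIV"
    and ram: "\<And>z. f z = a \<Longrightarrow> zorder (\<lambda>w. f w - a) z \<ge> int n"
  shows "entire_mat f ` carrier_mat n n \<inter> nontrivial_block_mats n a = {}"
proof (rule ccontr)
  assume "\<not> ?thesis"
  then obtain A where A: "A \<in> carrier_mat n n" "entire_mat f A \<in> nontrivial_block_mats n a" by blast
  then obtain n_as k where "jordan_nf (entire_mat f A) n_as" "k \<ge> 2" "(k, a) \<in> set n_as"
    unfolding nontrivial_block_mats_def by auto
  then show False
    using entire_mat_block_size_bound[OF f A(1), of n_as k a n 1] ram by auto
qed

lemma jordan_block_not_in_range:
  assumes f: "f holomorphic_on UNIV" "\<not> f constant_on UNIV"
    and ram: "\<And>z. f z = a \<Longrightarrow> zorder (\<lambda>w. f w - a) z \<ge> 2" and n: "n \<ge> 2"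
  shows "jordan_block n a \<in> nontrivial_block_mats n a - entire_mat f ` carrier_mat n n"
proof -
  have "similar_mat (jordan_block n a) (jordan_matrix [(n, a)])"
    using similar_mat_refl[OF jordan_block_carrier]
    by (simp only: jordan_matrix_def list.map prod.case diag_block_mat_singleton)
  then have nf: "jordan_nf (jordan_block n a) [(n, a)]"
    using n by (simp add: jordan_nf_def)
  have "jordan_block n a \<notin> entire_mat f ` carrier_mat n n"
  proof
    assume "jordan_block n a \<in> entire_mat f ` carrier_mat n n"
    then obtain A where A: "A \<in> carrier_mat n n" "jordan_block n a = entire_mat f A" by blast
    have "n \<le> n - 1"
      by (rule entire_mat_block_size_bound[OF f A(1) nf[unfolded A(2)], of n a 2]) (use ram n in auto)
    then show False using n by simp
  qed
  then show ?thesis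
    using nontrivial_block_mats_iff[OF nf jordan_block_carrier, of a] n by auto
qed

lemma simple_root_block:
  assumes f: "f holomorphic_on UNIV" "\<not> f constant_on UNIV"
    and b: "\<exists>z. f z = b" "\<not> totally_ramified_value f b"
  shows "\<exists>z. similar_mat (toeplitz_mat k (fps_expansion f z)) (jordan_block k b)"
proof -
  obtain z where z: "f z = b" "\<not> zorder (\<lambda>w. f w - b) z \<ge> 2"
    using b unfolding totally_ramified_value_def by auto
  obtain m where m: "m > 0" "zorder (\<lambda>w. f w - b) z = int m" "fps_nth (fps_expansion f z) m \<noteq> 0"
    using coeff_below_zorder(2)[OF f, of z] z(1) by auto
  have "m = 1" using m z(2) by simp
  then show ?thesis
    using toeplitz_mat_similar_jordan_block[of "fps_expansion f z" k] m(3) z(1) by auto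
qed

lemma size_one_block:
  assumes "\<exists>z. f z = b"
  shows "\<exists>z. similar_mat (toeplitz_mat 1 (fps_expansion f z)) (jordan_block 1 b)"
proof -
  obtain z where "f z = b" using assms by blast
  then have "toeplitz_mat 1 (fps_expansion f z) = jordan_block 1 b"
    by (intro eq_matI) (auto simp: jordan_block_def)
  then show ?thesis using similar_mat_refl[OF jordan_block_carrier] by metis
qed

text \<open>
  A block at a value that is not totally ramified is the image of a block at a simple root; at a
  totally ramified value only blocks of size \<open>1\<close> occur, and for these any root will do.
\<close>

lemma mem_range_if_no_ramified_block:
  assumes f: "f holomorphic_on UNIV" "\<not> f constant_on UNIV" and B: "B \<in> carrier_mat n n"
    and attained: "\<And>b. eigenvalue B b \<Longrightarrow> \<exists>z. f z = b"
    and free: "\<And>b. totally_ramified_value f b \<Longrightarrow> B \<notin> nontrivial_block_mats n b"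
  shows "B \<in> entire_mat f ` carrier_mat n n"
proof -
  obtain n_as where nf: "jordan_nf B n_as" using complex_jordan_nf_exists[OF B] by blast
  show ?thesis
  proof (rule mem_range_if_blocks_in_range[OF f(1) B nf])
    fix k b assume mem: "(k, b) \<in> set n_as"
    have k: "k \<ge> 1" using nf mem unfolding jordan_nf_def by force
    have "poly (char_poly B) b = 0"
      using jordan_nf_block_size_order_bound[OF nf mem] k by (metis order_0I not_one_le_zero le_zero_eq)
    then have att: "\<exists>z. f z = b"
      using attained eigenvalue_root_char_poly[OF B] by blast
    show "\<exists>z. similar_mat (toeplitz_mat k (fps_expansion f z)) (jordan_block k b)"
    proof (cases "totally_ramified_value f b")
      case True
      then have "\<not> k \<ge> 2"
        using free[OF True] nontrivial_block_mats_iff[OF nf B] mem by blast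
      then have "k = 1" using k by simp
      then show ?thesis using size_one_block[OF att] by simp
    next
      case False
      then show ?thesis by (rule simple_root_block[OF f att])
    qed
  qed
qed

lemma eigenvalue_entire_mat:
  assumes f: "f holomorphic_on UNIV" and A: "A \<in> carrier_mat n n" and ev: "eigenvalue (entire_mat f A) b"
  shows "\<exists>z. f z = b"
proof -
  have fA: "entire_mat f A \<in> carrier_mat n n" using A by simp
  obtain n_as where nf: "jordan_nf (entire_mat f A) n_as" using complex_jordan_nf_exists[OF fA] by blast
  have "poly (char_poly (entire_mat f A)) b = 0" using ev eigenvalue_root_char_poly[OF fA] by blast
  then have "(\<Prod>(k, a)\<leftarrow>n_as. poly ([:- a, 1:] ^ k) b) = 0"
    unfolding jordan_nf_char_poly[OF nf] by (simp add: poly_prod_list o_def case_prod_unfold)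
  then obtain k where "(k, b) \<in> set n_as"
    by (auto simp: prod_list_zero_iff)
  from entire_mat_block_source[OF f A nf this] show ?thesis by blast
qed

text \<open>
  The omitted value may be given the weight \<open>1 - 1 / 3\<close>, which with \<open>1 - 1 / 2\<close> for \<open>b\<close> exceeds \<open>1\<close>.
  This contains Picard's little theorem.
\<close>

lemma omitted_value_forces_simple_roots:
  assumes f: "f holomorphic_on UNIV" "\<not> f constant_on UNIV"
    and omitted: "\<And>z. f z \<noteq> a" and b: "b \<noteq> a"
  shows "\<exists>z. f z = b" and "\<not> totally_ramified_value f b"
proof -
  have no: "\<not> (\<forall>z. f z = b \<longrightarrow> zorder (\<lambda>w. f w - b) z \<ge> 2)"
  proof
    assume ram: "\<forall>z. f z = b \<longrightarrow> zorder (\<lambda>w. f w - b) z \<ge> 2"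
    have "(\<Sum>x\<in>{a, b}. 1 - 1 / real (if x = a then 3 else 2)) \<le> 1"
      by (rule ramification_defect[OF f]) (use ram omitted in \<open>auto split: if_splits\<close>)
    then show False using b by simp
  qed
  then show "\<exists>z. f z = b" and "\<not> totally_ramified_value f b"
    unfolding totally_ramified_value_def by auto
qed

text \<open>
  Three weights \<open>1 - 1 / 2\<close> exceed the total \<open>1\<close>.
\<close>

lemma at_most_two_totally_ramified_values:
  assumes f: "f holomorphic_on UNIV" "\<not> f constant_on UNIV"
    and "totally_ramified_value f a" "totally_ramified_value f b" "totally_ramified_value f c"
    and "a \<noteq> b"
  shows "c = a \<or> c = b"
proof (rule ccontr)
  assume c: "\<not> (c = a \<or> c = b)"
  have "(\<Sum>x\<in>{a, b, c}. 1 - 1 / real 2) \<le> 1"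
    by (rule ramification_defect[OF f]) (use assms(3-5) in \<open>auto simp: totally_ramified_value_def\<close>)
  then show False using c \<open>a \<noteq> b\<close> by auto
qed

text \<open>
  Otherwise \<open>a\<close> has the weight \<open>1 - 1 / 3\<close> and \<open>b\<close> the weight \<open>1 - 1 / 2\<close>. This is why the
  exceptional sets are proper for \<open>n \<ge> 3\<close>.
\<close>

lemma two_totally_ramified_values_double_root:
  assumes f: "f holomorphic_on UNIV" "\<not> f constant_on UNIV"
    and a: "totally_ramified_value f a" and b: "totally_ramified_value f b" and ne: "a \<noteq> b"
  shows "\<exists>z. f z = a \<and> zorder (\<lambda>w. f w - a) z = 2"
proof (rule ccontr)
  assume none: "\<not> ?thesis"
  have "(\<Sum>x\<in>{a, b}. 1 - 1 / real (if x = a then 3 else 2)) \<le> 1"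
  proof (rule ramification_defect[OF f])
    fix x z assume "x \<in> {a, b}" "f z = x"
    then show "zorder (\<lambda>w. f w - x) z \<ge> int (if x = a then 3 else 2)"
      using none a b unfolding totally_ramified_value_def by (cases "x = a") force+
  qed auto
  then show False using ne by simp
qed

lemma totally_ramified_imp_attains_all:
  assumes f: "f holomorphic_on UNIV" "\<not> f constant_on UNIV" and a: "totally_ramified_value f a"
  shows "\<exists>z. f z = b"
  using omitted_value_forces_simple_roots(2)[OF f, of b a] a unfolding totally_ramified_value_def by metis

theorem theorem1:
  fixes f :: "complex \<Rightarrow> complex" and n :: nat
  assumes "f holomorphic_on UNIV" and "\<not> f constant_on UNIV" and "n \<ge> 1"
  shows
    "(\<forall>a. (\<forall>z. f z \<noteq> a) \<longrightarrow>
        entire_mat f ` carrier_mat n n = carrier_mat n n - eigenvalue_mats n a) \<and>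
     (surj f \<and> (\<forall>a. \<not> totally_ramified_value f a) \<longrightarrow>
        entire_mat f ` carrier_mat n n = carrier_mat n n) \<and>
     (\<forall>a. totally_ramified_value f a \<and> (\<forall>b. totally_ramified_value f b \<longrightarrow> b = a) \<longrightarrow>
        (\<exists>S. entire_mat f ` carrier_mat n n = carrier_mat n n - S \<and>
             S \<subseteq> nontrivial_block_mats n a \<and>
             (n \<ge> 2 \<longrightarrow> S \<noteq> {}) \<and>
             (S = nontrivial_block_mats n a \<longleftrightarrow>
                (\<forall>z. f z = a \<longrightarrow> zorder (\<lambda>w. f w - a) z \<ge> int n)) \<and>
             (n = 2 \<longrightarrow> S = nontrivial_block_mats n a))) \<and>
     (\<forall>a b. a \<noteq> b \<and> totally_ramified_value f a \<and> totally_ramified_value f b \<longrightarrow>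
        (\<exists>Sa Sb. Sa \<subseteq> nontrivial_block_mats n a \<and>
             Sb \<subseteq> nontrivial_block_mats n b \<and>
             entire_mat f ` carrier_mat n n = carrier_mat n n - (Sa \<union> Sb) \<and>
             (n \<ge> 3 \<longrightarrow>
                Sa \<noteq> {} \<and> Sa \<subset> nontrivial_block_mats n a \<and>
                Sb \<noteq> {} \<and> Sb \<subset> nontrivial_block_mats n b) \<and>
             (n = 2 \<longrightarrow>
                Sa = nontrivial_block_mats n a \<and> Sb = nontrivial_block_mats n b)))"
proof (intro conjI allI impI; (elim conjE)?)
  note f = assms(1,2)
  let ?R = "entire_mat f ` carrier_mat n n"
  have R: "?R \<subseteq> carrier_mat n n" by auto
  have sub: "nontrivial_block_mats n a \<subseteq> carrier_mat n n" for a
    by (auto simp: nontrivial_block_mats_def)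
  {
    fix a assume omitted: "\<forall>z. f z \<noteq> a"
    have unramified: "\<not> totally_ramified_value f b" for b
      using omitted_value_forces_simple_roots(2)[OF f, of a b] omitted
      by (cases "b = a") (auto simp: totally_ramified_value_def)
    have "B \<in> ?R" if B: "B \<in> carrier_mat n n" "B \<notin> eigenvalue_mats n a" for B
    proof (rule mem_range_if_no_ramified_block[OF f B(1)])
      fix b assume "eigenvalue B b"
      then have "b \<noteq> a" using B by (auto simp: eigenvalue_mats_def)
      then show "\<exists>z. f z = b" using omitted_value_forces_simple_roots(1)[OF f] omitted by blast
    qed (use unramified in blast)
    moreover have "?R \<inter> eigenvalue_mats n a = {}"
      using eigenvalue_entire_mat[OF f(1)] omitted unfolding eigenvalue_mats_def by blast
    ultimately show "?R = carrier_mat n n - eigenvalue_mats n a" using R by blast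
  next
    assume "surj f" and none: "\<forall>a. \<not> totally_ramified_value f a"
    have "B \<in> ?R" if B: "B \<in> carrier_mat n n" for B
      using \<open>surj f\<close> none by (intro mem_range_if_no_ramified_block[OF f B]) (auto simp: surj_def, metis)
    then show "?R = carrier_mat n n" using R by blast
  next
    fix a assume a: "totally_ramified_value f a" and only: "\<forall>b. totally_ramified_value f b \<longrightarrow> b = a"
    define S where "S = carrier_mat n n - ?R"
    have 1: "?R = carrier_mat n n - S" unfolding S_def using R by blast
    have 2: "S \<subseteq> nontrivial_block_mats n a"
    proof (rule subsetI, rule ccontr)
      fix B assume "B \<in> S" "B \<notin> nontrivial_block_mats n a"
      moreover from this have "B \<in> ?R"
        using only totally_ramified_imp_attains_all[OF f a]
        by (intro mem_range_if_no_ramified_block[OF f]) (auto simp: S_def)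
      ultimately show False by (simp add: S_def)
    qed
    have 3: "S \<noteq> {}" if "n \<ge> 2"
      using jordan_block_not_in_range[OF f _ that, of a] a sub[of a]
      unfolding S_def totally_ramified_value_def by blast
    have 4: "S = nontrivial_block_mats n a \<longleftrightarrow> (\<forall>z. f z = a \<longrightarrow> zorder (\<lambda>w. f w - a) z \<ge> int n)"
    proof
      assume S: "S = nontrivial_block_mats n a"
      show "\<forall>z. f z = a \<longrightarrow> zorder (\<lambda>w. f w - a) z \<ge> int n"
      proof (rule ccontr)
        assume "\<not> ?thesis"
        then obtain z where "f z = a" "zorder (\<lambda>w. f w - a) z < int n" by force
        then have "?R \<inter> nontrivial_block_mats n a \<noteq> {}"
          using a by (intro range_meets_nontrivial_block_mats[OF f]) (auto simp: totally_ramified_value_def)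
        then show False using S unfolding S_def by blast
      qed
    next
      assume "\<forall>z. f z = a \<longrightarrow> zorder (\<lambda>w. f w - a) z \<ge> int n"
      then have "?R \<inter> nontrivial_block_mats n a = {}"
        by (intro nontrivial_block_mats_disjoint_range[OF f]) auto
      then show "S = nontrivial_block_mats n a" using 2 sub[of a] unfolding S_def by blast
    qed
    have 5: "S = nontrivial_block_mats n a" if "n = 2"
      unfolding 4 using a that by (auto simp: totally_ramified_value_def)
    show "\<exists>S. ?R = carrier_mat n n - S \<and> S \<subseteq> nontrivial_block_mats n a \<and> (n \<ge> 2 \<longrightarrow> S \<noteq> {}) \<and>
             (S = nontrivial_block_mats n a \<longleftrightarrow>
                (\<forall>z. f z = a \<longrightarrow> zorder (\<lambda>w. f w - a) z \<ge> int n)) \<and>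
             (n = 2 \<longrightarrow> S = nontrivial_block_mats n a)"
      using 1 2 3 4 5 by (intro exI[of _ S] conjI impI)
  next
    fix a b assume ab: "a \<noteq> b" "totally_ramified_value f a" "totally_ramified_value f b"
    define S where "S c = nontrivial_block_mats n c - ?R" for c
    have sub_blocks: "S c \<subseteq> nontrivial_block_mats n c" for c by (auto simp: S_def)
    have 1: "?R = carrier_mat n n - (S a \<union> S b)"
    proof -
      have "B \<in> ?R" if B_mem: "B \<in> carrier_mat n n" and B_S: "B \<notin> S a \<union> S b" for B
      proof (rule ccontr)
        assume B: "B \<notin> ?R"
        have "B \<in> ?R"
        proof (rule mem_range_if_no_ramified_block[OF f B_mem])
          fix c assume "totally_ramified_value f c"
          then have "c = a \<or> c = b"
            using at_most_two_totally_ramified_values[OF f ab(2,3) _ ab(1)] by blast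
          then show "B \<notin> nontrivial_block_mats n c" using B_S B by (auto simp: S_def)
        qed (rule totally_ramified_imp_attains_all[OF f ab(2)])
        then show False using B by blast
      qed
      then show ?thesis using R by (auto simp: S_def)
    qed
    have 2: "S c \<noteq> {} \<and> S c \<subset> nontrivial_block_mats n c"
      if "n \<ge> 3" and c: "totally_ramified_value f c" and d: "totally_ramified_value f d" "c \<noteq> d" for c d
    proof -
      obtain z where "f z = c" "zorder (\<lambda>w. f w - c) z = 2"
        using two_totally_ramified_values_double_root[OF f c d] by blast
      then have "?R \<inter> nontrivial_block_mats n c \<noteq> {}"
        using \<open>n \<ge> 3\<close> by (intro range_meets_nontrivial_block_mats[OF f]) auto
      moreover have "S c \<noteq> {}"
        using jordan_block_not_in_range[OF f, of c n] \<open>n \<ge> 3\<close> c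
        unfolding S_def totally_ramified_value_def by auto
      ultimately show ?thesis unfolding S_def by blast
    qed
    have 3: "S c = nontrivial_block_mats n c" if "n = 2" "totally_ramified_value f c" for c
      using nontrivial_block_mats_disjoint_range[OF f, of c n] that
      unfolding S_def totally_ramified_value_def by auto
    have large: "S a \<noteq> {} \<and> S a \<subset> nontrivial_block_mats n a \<and>
        S b \<noteq> {} \<and> S b \<subset> nontrivial_block_mats n b" if "n \<ge> 3"
      using 2[OF that ab(2,3,1)] 2[OF that ab(3,2) ab(1)[symmetric]] by blast
    have two: "S a = nontrivial_block_mats n a \<and> S b = nontrivial_block_mats n b" if "n = 2"
      using 3[OF that ab(2)] 3[OF that ab(3)] by blast
    show "\<exists>Sa Sb. Sa \<subseteq> nontrivial_block_mats n a \<and> Sb \<subseteq> nontrivial_block_mats n b \<and>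
             ?R = carrier_mat n n - (Sa \<union> Sb) \<and>
             (n \<ge> 3 \<longrightarrow>
                Sa \<noteq> {} \<and> Sa \<subset> nontrivial_block_mats n a \<and>
                Sb \<noteq> {} \<and> Sb \<subset> nontrivial_block_mats n b) \<and>
             (n = 2 \<longrightarrow>
                Sa = nontrivial_block_mats n a \<and> Sb = nontrivial_block_mats n b)"
      by (rule exI[of _ "S a"], rule exI[of _ "S b"])
        (rule conjI[OF sub_blocks conjI[OF sub_blocks conjI[OF 1 conjI[OF impI[OF large] impI[OF two]]]]])
  }
qed

end
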